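(* Let $\underline\lambda,\overline\lambda\in\mathbb{R}_{\ge 0}$ with $\underline\lambda\le\overline\lambda$, and write $\overline{\mathrm E}[\,\cdot\mid\cdot\,]$ for the conditional upper expectation $\overline{\mathrm E}_{[\underline\lambda,\overline\lambda]}[\,\cdot\mid\cdot\,]$. For all $k\in\mathbb{N}$, all time points $t_1<t_2<\cdots<t_{k+1}$ in $\mathbb{R}_{\ge 0}$ and all bounded functions $g\colon(\mathbb{Z}_{\ge 0})^{k+1}\to\mathbb{R}$, $$\overline{\mathrm E}\big[g(N_{t_1},\dots,N_{t_{k+1}})\mid t_1\big]=\overline{\mathrm E}\Big[\,\overline{\mathrm E}\big[g(N_{t_1},\dots,N_{t_{k+1}})\mid t_k\big]\;\Big|\;t_1\Big]$$ as functions on $\Omega$, where $\overline{\mathrm E}[g(N_{t_1},\dots,N_{t_{k+1}})\mid t_k]$ on the right-hand side is the extended real variable $\varpi\mapsto\overline{\mathrm E}[g(N_{t_1},\dots,N_{t_{k+1}})\mid t_k](\varpi)$ on $\Omega$.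
   Context: Conventions: $\mathbb{N}=\{1,2,\dots\}$; $\mathbb{R}_{\ge 0}=[0,+\infty)$; $\overline{\mathbb{R}}=\mathbb{R}\cup\{-\infty,+\infty\}$ with $+\infty-\infty=+\infty$; $\inf\emptyset=+\infty$; "increasing" means nondecreasing. Paths and variables. $\Omega$ is the set of counting paths: maps $\omega\colon\mathbb{R}_{\ge 0}\to\mathbb{Z}_{\ge 0}$ with $\omega(0)=0$ that are nondecreasing with unit jumps (every jump has size $1$) and right-continuous. A (partial) extended real variable is a map from (a subset of) $\Omega$ to $\overline{\mathbb{R}}$; "real" means it takes values in $\mathbb{R}$. For $t\in\mathbb{R}_{\ge 0}$, $N_t(\omega)=\omega(t)$. A stopping time is a map $\tau\colon\Omega\to[0,+\infty]$ such that for all $\omega_1,\omega_2\in\Omega$, if $\omega_1,\omega_2$ agree on $[0,\tau(\omega_1)]\cap\mathbb{R}_{\ge 0}$ then $\tau(\omega_1)=\tau(\omega_2)$; every $t\in\mathbb{R}_{\ge 0}$ is identified with the constant stopping time $t$. For a real-valued stopping time $\sigma$, $N_\sigma(\omega)=\omega(\sigma(\omega))$. For a stopping time $\tau$ and $\omega\in\Omega$, $\mathcal{I}_\tau(\omega)$ is the set of $\varpi\in\Omega$ that agree with $\omega$ on $[0,\tau(\omega)]\cap\mathbb{R}_{\ge 0}$. A partial variable $f$ is $\tau$-measurable if $f(\omega_1)=f(\omega_2)$ for all $\omega_1,\omega_2\in\operatorname{dom}f$ that agree on $[0,\tau(\omega_1)]\cap\mathbb{R}_{\ge 0}$. $\{\tau<+\infty\}=\{\omega\in\Omega:\tau(\omega)<+\infty\}$,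 and $\overline{\mathbb{V}}_\tau$ is the set of extended real partial variables whose domain includes $\{\tau<+\infty\}$. A process is a family $\mathcal{S}_\bullet=(\mathcal{S}_t)_{t\in\mathbb{R}_{\ge 0}}$ of real variables on $\Omega$ with $\mathcal{S}_t$ $t$-measurable for all $t$; $\inf\mathcal{S}_\bullet=\inf_{t,\omega}\mathcal{S}_t(\omega)$; $\mathcal{S}_\tau(\omega)=\mathcal{S}_{\tau(\omega)}(\omega)$ for $\omega\in\{\tau<+\infty\}$; $\liminf\mathcal{S}_\bullet(\omega)=\liminf_{t\to+\infty}\mathcal{S}_t(\omega)$. Capital processes. A one-sided elementary trading strategy $G$ consists of finitely many stopping times $\tau_1\le\tau_2\le\cdots\le\tau_{n+1}$ ($n\in\mathbb{N}$) and stakes $\overline h_1,\underline h_1,\dots,\overline h_n,\underline h_n$, where $\overline h_k,\underline h_k$ are $\tau_k$-measurable bounded nonnegative real (possibly partial) variables whose domains include $\{\tau_k<+\infty\}$. With initial capital $c\in\mathbb{R}$ its capital process is $$\mathcal{K}^{G,c}_t=c+\sum_{k=1}^n\Big(\overline h_k\big(N_{\tau_{k+1}\wedge t}-N_{\tau_k\wedge t}-\overline\lambda(\tau_{k+1}\wedge t-\tau_k\wedge t)\big)+\underline h_k\big(\underline\lambda(\tau_{k+1}\wedge t-\tau_k\wedge t)-N_{\tau_{k+1}\wedge t}+N_{\tau_k\wedge t}\big)\Big),$$ where terms with $\tau_k(\omega)\wedge t=\tau_{k+1}(\omega)\wedge t$ count as zero. $\mathfrak{K}_{[\underline\lambda,\overline\lambda]}$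 is the set of all such processes $\mathcal{K}^{G,c}_\bullet$. Upper expectation. For a stopping time $\tau$, $f\in\overline{\mathbb{V}}_\tau$ and $\omega\in\{\tau<+\infty\}$, $$\overline{\mathrm E}_{[\underline\lambda,\overline\lambda]}[f\mid\tau](\omega)=\inf\{\mathcal{K}_\tau(\omega):\mathcal{K}_\bullet\in\mathfrak{K}_{[\underline\lambda,\overline\lambda]},\ \inf\mathcal{K}_\bullet>-\infty,\ \liminf\mathcal{K}_\bullet(\varpi)\ge f(\varpi)\ \forall\varpi\in\mathcal{I}_\tau(\omega)\}.$$ *)

theory Defs
  imports "HOL-Analysis.Analysis"
begin

definition jump :: "(real \<Rightarrow> nat) \<Rightarrow> real \<Rightarrow> real" where
  "jump \<omega> t = real (\<omega> t) - Lim (at_left t) (\<lambda>s. real (\<omega> s))"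

text \<open>Paths live on \<open>{0..}\<close>; setting them to \<open>0\<close> at negative arguments makes
  equality of representing functions coincide with equality of paths. The left limit in
  \<open>jump\<close> exists for \<open>t > 0\<close> because paths are nondecreasing.\<close>

typedef counting_path =
  "{\<omega> :: real \<Rightarrow> nat.
      (\<forall>t<0. \<omega> t = 0) \<and> \<omega> 0 = 0 \<and> mono_on {0..} \<omega> \<and>
      (\<forall>t\<ge>0. continuous (at_right t) (\<lambda>s. real (\<omega> s))) \<and>
      (\<forall>t>0. jump \<omega> t \<noteq> 0 \<longrightarrow> jump \<omega> t = 1)}"
  by (rule exI[of _ "\<lambda>_. 0"]) (auto simp: jump_def mono_on_def intro: tendsto_Lim)

definition N :: "real \<Rightarrow> counting_path \<Rightarrow> nat" where
  "N t \<omega> = Rep_counting_path \<omega> t"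

definition agree_upto :: "ereal \<Rightarrow> counting_path \<Rightarrow> counting_path \<Rightarrow> bool" where
  "agree_upto T \<omega>\<^sub>1 \<omega>\<^sub>2 \<longleftrightarrow> (\<forall>s\<ge>0. ereal s \<le> T \<longrightarrow> N s \<omega>\<^sub>1 = N s \<omega>\<^sub>2)"

definition stopping_time :: "(counting_path \<Rightarrow> ereal) \<Rightarrow> bool" where
  "stopping_time \<tau> \<longleftrightarrow> (\<forall>\<omega>. 0 \<le> \<tau> \<omega>) \<and>
     (\<forall>\<omega>\<^sub>1 \<omega>\<^sub>2. agree_upto (\<tau> \<omega>\<^sub>1) \<omega>\<^sub>1 \<omega>\<^sub>2 \<longrightarrow> \<tau> \<omega>\<^sub>1 = \<tau> \<omega>\<^sub>2)"

definition const_time :: "real \<Rightarrow> counting_path \<Rightarrow> ereal" where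
  "const_time t = (\<lambda>_. ereal t)"

definition atom :: "(counting_path \<Rightarrow> ereal) \<Rightarrow> counting_path \<Rightarrow> counting_path set" where
  "atom \<tau> \<omega> = {\<omega>'. agree_upto (\<tau> \<omega>) \<omega> \<omega>'}"

text \<open>Partial variables are maps into an option type; their domain is \<open>dom f\<close>.\<close>

definition measurable_upto ::
    "(counting_path \<Rightarrow> ereal) \<Rightarrow> (counting_path \<rightharpoonup> 'a) \<Rightarrow> bool" where
  "measurable_upto \<tau> f \<longleftrightarrow>
     (\<forall>\<omega>\<^sub>1\<in>dom f. \<forall>\<omega>\<^sub>2\<in>dom f. agree_upto (\<tau> \<omega>\<^sub>1) \<omega>\<^sub>1 \<omega>\<^sub>2 \<longrightarrow> f \<omega>\<^sub>1 = f \<omega>\<^sub>2)"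

definition stake :: "(counting_path \<Rightarrow> ereal) \<Rightarrow> (counting_path \<rightharpoonup> real) \<Rightarrow> bool" where
  "stake \<tau> h \<longleftrightarrow> {\<omega>. \<tau> \<omega> < \<infinity>} \<subseteq> dom h \<and> measurable_upto \<tau> h \<and>
     bounded (ran h) \<and> (\<forall>x\<in>ran h. 0 \<le> x)"

definition trading_strategy ::
    "nat \<Rightarrow> (nat \<Rightarrow> counting_path \<Rightarrow> ereal) \<Rightarrow> (nat \<Rightarrow> counting_path \<rightharpoonup> real) \<Rightarrow>
     (nat \<Rightarrow> counting_path \<rightharpoonup> real) \<Rightarrow> bool" where
  "trading_strategy n \<tau> h_up h_lo \<longleftrightarrow> 1 \<le> n \<and>
     (\<forall>k\<in>{1..n+1}. stopping_time (\<tau> k)) \<and>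
     (\<forall>k\<in>{1..n}. \<forall>\<omega>. \<tau> k \<omega> \<le> \<tau> (k+1) \<omega>) \<and>
     (\<forall>k\<in>{1..n}. stake (\<tau> k) (h_up k) \<and> stake (\<tau> k) (h_lo k))"

definition stop_at :: "(counting_path \<Rightarrow> ereal) \<Rightarrow> real \<Rightarrow> counting_path \<Rightarrow> real" where
  "stop_at \<tau> t \<omega> = real_of_ereal (min (\<tau> \<omega>) (ereal t))"

text \<open>The case \<open>a = b\<close> covers the paths on which the stakes may be undefined, since
  \<open>a \<noteq> b\<close> forces \<open>\<tau> k \<omega> < \<infinity>\<close>. Only the values at \<open>t \<ge> 0\<close> are meaningful.\<close>

definition capital ::
    "real \<Rightarrow> real \<Rightarrow> nat \<Rightarrow> (nat \<Rightarrow> counting_path \<Rightarrow> ereal) \<Rightarrow> (nat \<Rightarrow> counting_path \<rightharpoonup> real) \<Rightarrow>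
     (nat \<Rightarrow> counting_path \<rightharpoonup> real) \<Rightarrow> real \<Rightarrow> real \<Rightarrow> counting_path \<Rightarrow> real" where
  "capital lo hi n \<tau> h_up h_lo c t \<omega> = c + (\<Sum>k=1..n.
     let a = stop_at (\<tau> k) t \<omega>; b = stop_at (\<tau> (k+1)) t \<omega>
     in if a = b then 0
        else the (h_up k \<omega>) * (real (N b \<omega>) - real (N a \<omega>) - hi * (b - a)) +
             the (h_lo k \<omega>) * (lo * (b - a) - real (N b \<omega>) + real (N a \<omega>)))"

definition capital_processes :: "real \<Rightarrow> real \<Rightarrow> (real \<Rightarrow> counting_path \<Rightarrow> real) set" where
  "capital_processes lo hi =
     {capital lo hi n \<tau> h_up h_lo c | n \<tau> h_up h_lo c. trading_strategy n \<tau> h_up h_lo}"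

text \<open>The conditional upper expectation is itself a partial variable, with domain
  \<open>{\<omega>. \<tau> \<omega> < \<infinity>}\<close>. It is meant for stopping times \<open>\<tau>\<close> and variables \<open>f\<close> whose domain
  includes \<open>{\<omega>. \<tau> \<omega> < \<infinity>}\<close>; then \<open>f\<close> is defined on every atom occurring below.\<close>

definition upper_expectation ::
    "real \<Rightarrow> real \<Rightarrow> (counting_path \<rightharpoonup> ereal) \<Rightarrow> (counting_path \<Rightarrow> ereal) \<Rightarrow>
     (counting_path \<rightharpoonup> ereal)" where
  "upper_expectation lo hi f \<tau> = (\<lambda>\<omega>.
     if \<tau> \<omega> < \<infinity> then
       Some (Inf {ereal (K (real_of_ereal (\<tau> \<omega>)) \<omega>) | K.
         K \<in> capital_processes lo hi \<and>
         (INF (t, \<omega>') \<in> {0..} \<times> UNIV. ereal (K t \<omega>')) > -\<infinity> \<and>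
         (\<forall>\<omega>'\<in>atom \<tau> \<omega>. Liminf at_top (\<lambda>t. ereal (K t \<omega>')) \<ge> the (f \<omega>'))})
     else None)"

end

theory Submission imports Defs begin

text \<open>
Write \<open>a = t k\<close> and \<open>b = t (k + 1)\<close>. One inequality is easy: a strategy that superhedges the claim
can be stopped at time \<open>a\<close>, where its capital is at least the conditional upper expectation
(\<open>stopped_dominates_conditional\<close>).

For the other inequality, a strategy that ends above the conditional upper expectation has to be
continued after \<open>a\<close> by a strategy that superhedges the claim itself, chosen according to
the path so far (\<open>conditional_dominated_then_dominated\<close>). Two obstacles arise.

First, the capital of the given strategy at time \<open>a\<close> must suffice for the continuation, though
only its final capital is known to be large. This is coherence
(\<open>capital_ge_of_Liminf_ge\<close>): against every strategy there is a continuation of the path along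
which it gains almost nothing. It is built phase by phase and without probability: depending on the
sign of the net stake, the path either stays constant or jumps at a fast regular pace.
Coherence also bounds the capital of a superhedge from below.

Second, there are infinitely many continuations to choose from, but together they have to form one
elementary strategy with finitely many stopping times and bounded stakes. So the
superhedges of all claims bounded by a common constant must be found, up to \<open>\<epsilon>\<close>, with the same
number of phases and the same bound on the stakes (\<open>uniform_superhedge\<close>). The claim depends on the
future only through the increment \<open>N b - N a\<close>. Large increments are cheap to insure, because a
stake of \<open>1 / M\<close> on jumps pays \<open>1\<close> after \<open>M\<close> jumps and costs \<open>hi (b - a) / M\<close>. For the increments
below \<open>M\<close>, a bounded claim is within \<open>\<epsilon>\<close> of one of finitely many rounded claims, and finitely many
superhedges do have a common bound.
\<close>

section \<open>Counting paths\<close>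
lemma N_neg: "t \<le> 0 \<Longrightarrow> N t \<omega> = 0"
  using Rep_counting_path[of \<omega>] by (cases "t = 0") (auto simp: N_def)

lemma N_mono: "s \<le> t \<Longrightarrow> N s \<omega> \<le> N t \<omega>"
  using Rep_counting_path[of \<omega>] N_neg[of s \<omega>]
  by (cases "s \<ge> 0") (auto simp: N_def mono_on_def)

lemma eventually_at_left_less: "\<forall>\<^sub>F s in at_left t. s < (t :: real)"
  by (auto simp: eventually_at_filter)

text \<open>A monotone function into the naturals is bounded on the left of any point, so it reaches its
  supremum there and is constant between there and that point.\<close>
lemma left_limit_attained:
  fixes w :: "real \<Rightarrow> nat"
  assumes "mono w"
  obtains L where "\<forall>\<^sub>F s in at_left t. w s = L"
proof -
  have fin: "finite (w ` {..<t})"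
    by (rule finite_subset[of _ "{..w t}"]) (auto intro: monoD[OF assms])
  have ne: "w ` {..<t} \<noteq> {}" using lt_ex[of t] by auto
  obtain s0 where s0: "s0 < t" "Max (w ` {..<t}) = w s0"
    using Max_in[OF fin ne] by auto
  have "w s = w s0" if "s0 < s" "s < t" for s
    using that s0 Max_ge[OF fin, of "w s"] monoD[OF assms, of s0 s] by (intro antisym) auto
  then have "\<forall>\<^sub>F s in at_left t. w s = w s0"
    unfolding eventually_at_left_field using s0 by auto
  then show ?thesis using that by blast
qed

lemma jump_eq:
  assumes "\<forall>\<^sub>F s in at_left t. w s = L"
  shows "jump w t = real (w t) - real L"
proof -
  have "((\<lambda>s. real (w s)) \<longlongrightarrow> real L) (at_left t)"
    using assms by (intro tendsto_eventually) (auto elim: eventually_mono)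
  then have "Lim (at_left t) (\<lambda>s. real (w s)) = real L"
    by (intro tendsto_Lim) auto
  then show ?thesis by (simp add: jump_def)
qed

lemma N_right:
  assumes "0 \<le> t" shows "\<forall>\<^sub>F s in at_right t. N s \<omega> = N t \<omega>"
proof -
  have "((\<lambda>s. real (N s \<omega>)) \<longlongrightarrow> real (N t \<omega>)) (at_right t)"
    using Rep_counting_path[of \<omega>] assms by (auto simp: N_def continuous_within)
  then have "\<forall>\<^sub>F s in at_right t. dist (real (N s \<omega>)) (real (N t \<omega>)) < 1"
    by (rule tendstoD) auto
  then show ?thesis by eventually_elim (auto simp: dist_real_def)
qed

lemma N_left:
  assumes "0 < t" shows "\<forall>\<^sub>F s in at_left t. N t \<omega> \<le> Suc (N s \<omega>)"
proof -
  have "mono (\<lambda>s. N s \<omega>)" by (auto simp: mono_def N_mono)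
  then obtain L where L: "\<forall>\<^sub>F s in at_left t. N s \<omega> = L"
    by (rule left_limit_attained)
  have "jump (\<lambda>s. N s \<omega>) t = real (N t \<omega>) - real L"
    using L by (rule jump_eq)
  moreover have "jump (\<lambda>s. N s \<omega>) t \<noteq> 0 \<longrightarrow> jump (\<lambda>s. N s \<omega>) t = 1"
    using Rep_counting_path[of \<omega>] assms by (auto simp: N_def)
  ultimately have "N t \<omega> \<le> Suc L" by linarith
  with L show ?thesis by (auto elim: eventually_mono)
qed

text \<open>The conditions on a counting path, with limits replaced by eventual statements about natural
  numbers; in this form they can be checked for explicitly given functions.\<close>
lemma N_Abs:
  assumes "\<And>t. t \<le> 0 \<Longrightarrow> w t = 0" and "mono w"
    and right: "\<And>t. 0 \<le> t \<Longrightarrow> \<forall>\<^sub>F s in at_right t. w s = w t"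
    and left: "\<And>t. 0 < t \<Longrightarrow> \<forall>\<^sub>F s in at_left t. w t \<le> Suc (w s)"
  shows "N t (Abs_counting_path w) = w t"
proof -
  have "jump w t = 1" if "0 < t" "jump w t \<noteq> 0" for t
  proof -
    obtain L where L: "\<forall>\<^sub>F s in at_left t. w s = L"
      using \<open>mono w\<close> by (rule left_limit_attained)
    from L left[OF \<open>0 < t\<close>] have "\<forall>\<^sub>F s in at_left t. L \<le> w t \<and> w t \<le> Suc L"
      using eventually_at_left_less[of t]
      by eventually_elim (use monoD[OF \<open>mono w\<close>, of _ t] in auto)
    then have "L \<le> w t \<and> w t \<le> Suc L" by (simp add: eventually_const)
    then show ?thesis using that jump_eq[OF L] by auto
  qed
  moreover have "continuous (at_right t) (\<lambda>s. real (w s))" if "0 \<le> t" for t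
    unfolding continuous_within
    using right[OF that] by (intro tendsto_eventually) (auto elim: eventually_mono)
  ultimately have "w \<in> {\<omega>. (\<forall>t<0. \<omega> t = 0) \<and> \<omega> 0 = 0 \<and> mono_on {0..} \<omega> \<and>
      (\<forall>t\<ge>0. continuous (at_right t) (\<lambda>s. real (\<omega> s))) \<and>
      (\<forall>t>0. jump \<omega> t \<noteq> 0 \<longrightarrow> jump \<omega> t = 1)}"
    using assms(1) monoD[OF \<open>mono w\<close>] by (auto intro!: mono_onI)
  then show ?thesis by (simp add: N_def Abs_counting_path_inverse)
qed

text \<open>The path that follows \<open>\<eta>\<close> up to time \<open>a\<close> and repeats the increments of \<open>\<omega>\<close> afterwards.
  Grafting serves two purposes: it builds the adverse paths in the coherence argument, and it
  carries a superhedge from one past to every other.\<close>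
definition graft :: "counting_path \<Rightarrow> real \<Rightarrow> counting_path \<Rightarrow> counting_path" where
  "graft \<eta> a \<omega> =
     Abs_counting_path (\<lambda>s. if s \<le> a then N s \<eta> else N a \<eta> + (N s \<omega> - N a \<omega>))"

lemma N_graft:
  assumes a: "0 \<le> a"
  shows "N s (graft \<eta> a \<omega>) = (if s \<le> a then N s \<eta> else N a \<eta> + (N s \<omega> - N a \<omega>))"
  unfolding graft_def
proof (rule N_Abs)
  let ?w = "\<lambda>s. if s \<le> a then N s \<eta> else N a \<eta> + (N s \<omega> - N a \<omega>)"
  show "?w t = 0" if "t \<le> 0" for t using that a by (simp add: N_neg)
  show "mono ?w"
    unfolding mono_def
  proof (intro allI impI)
    fix x y :: real assume "x \<le> y"
    then show "?w x \<le> ?w y"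
      using N_mono[of x y \<eta>] N_mono[of x a \<eta>] N_mono[of x y \<omega>] by auto
  qed
  show "\<forall>\<^sub>F s in at_right t. ?w s = ?w t" if t: "0 \<le> t" for t
  proof (cases "t < a")
    case True
    then have "\<forall>\<^sub>F s in at_right t. s < a" by (auto simp: eventually_at_right_field)
    with N_right[OF t, of \<eta>] show ?thesis by eventually_elim (use True in auto)
  next
    case False
    have "\<forall>\<^sub>F s in at_right t. t < s" by (rule eventually_at_right_less)
    with N_right[OF t, of \<omega>] show ?thesis by eventually_elim (use False in auto)
  qed
  show "\<forall>\<^sub>F s in at_left t. ?w t \<le> Suc (?w s)" if t: "0 < t" for t
  proof (cases "t \<le> a")
    case True
    from N_left[OF t, of \<eta>] eventually_at_left_less[of t]
    show ?thesis by eventually_elim (use True in auto)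
  next
    case False
    then have "\<forall>\<^sub>F s in at_left t. a < s"
      by (auto simp: eventually_at_left_field intro!: exI[of _ a])
    with N_left[OF t, of \<omega>] show ?thesis by eventually_elim (use False in auto)
  qed
qed

lemma agree_graft: "0 \<le> a \<Longrightarrow> T \<le> ereal a \<Longrightarrow> agree_upto T \<eta> (graft \<eta> a \<omega>)"
  unfolding agree_upto_def by (metis N_graft ereal_less_eq(3) order_trans)

lemma agree_refl: "agree_upto T \<omega> \<omega>" by (simp add: agree_upto_def)

lemma agree_sym: "agree_upto T \<omega>\<^sub>1 \<omega>\<^sub>2 \<Longrightarrow> agree_upto T \<omega>\<^sub>2 \<omega>\<^sub>1"
  by (auto simp: agree_upto_def)

lemma agree_trans: "agree_upto T \<omega>\<^sub>1 \<omega>\<^sub>2 \<Longrightarrow> agree_upto T \<omega>\<^sub>2 \<omega>\<^sub>3 \<Longrightarrow> agree_upto T \<omega>\<^sub>1 \<omega>\<^sub>3"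
  by (auto simp: agree_upto_def)

lemma agree_le: "agree_upto T \<omega>\<^sub>1 \<omega>\<^sub>2 \<Longrightarrow> S \<le> T \<Longrightarrow> agree_upto S \<omega>\<^sub>1 \<omega>\<^sub>2"
  unfolding agree_upto_def by (meson order_trans)

lemma agree_N: "agree_upto T \<omega>\<^sub>1 \<omega>\<^sub>2 \<Longrightarrow> ereal s \<le> T \<Longrightarrow> N s \<omega>\<^sub>1 = N s \<omega>\<^sub>2"
  by (cases "s \<ge> 0") (auto simp: agree_upto_def N_neg)

text \<open>A path that jumps at the times \<open>u + \<delta>, u + 2\<delta>, \<dots>\<close> only.\<close>
lemma regular_path:
  assumes u: "0 \<le> u" and d: "0 < \<delta>"
  obtains \<omega> where "\<And>s. N s \<omega> = nat \<lfloor>(s - u) / \<delta>\<rfloor>"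
proof -
  let ?w = "\<lambda>s. nat \<lfloor>(s - u) / \<delta>\<rfloor>"
  have "N s (Abs_counting_path ?w) = ?w s" for s
  proof (rule N_Abs)
    show "?w t = 0" if "t \<le> 0" for t
    proof -
      have "(t - u) / \<delta> \<le> 0" using that u d by (simp add: divide_le_0_iff)
      then show ?thesis by (simp add: floor_le_iff)
    qed
    show "mono ?w" using d
      by (auto simp: mono_def intro!: nat_mono floor_mono divide_right_mono)
    show "\<forall>\<^sub>F s in at_right t. ?w s = ?w t" for t
    proof -
      let ?f = "\<lfloor>(t - u) / \<delta>\<rfloor>"
      have "t < u + \<delta> * (?f + 1)" using d floor_correct[of "(t - u) / \<delta>"]
        by (simp add: field_simps)
      moreover have "\<lfloor>(s - u) / \<delta>\<rfloor> = ?f" if "t < s" "s < u + \<delta> * (?f + 1)" for s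
      proof (rule floor_unique)
        have "(t - u) / \<delta> \<le> (s - u) / \<delta>" using that d by (simp add: divide_right_mono)
        then show "of_int ?f \<le> (s - u) / \<delta>" using of_int_floor_le[of "(t - u) / \<delta>"] by linarith
        show "(s - u) / \<delta> < of_int ?f + 1" using that d by (simp add: field_simps)
      qed
      ultimately show ?thesis unfolding eventually_at_right_field by auto
    qed
    show "\<forall>\<^sub>F s in at_left t. ?w t \<le> Suc (?w s)" for t
    proof -
      have "?w t \<le> Suc (?w s)" if "t - \<delta> < s" for s
      proof -
        have "(t - u) / \<delta> \<le> (s - u) / \<delta> + 1" using that d by (simp add: field_simps)
        then have "\<lfloor>(t - u) / \<delta>\<rfloor> \<le> \<lfloor>(s - u) / \<delta>\<rfloor> + 1" by linarith
        then show ?thesis by linarith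
      qed
      moreover have "t - \<delta> < t" using d by simp
      ultimately show ?thesis unfolding eventually_at_left_field by blast
    qed
  qed
  then show ?thesis using that by blast
qed

section \<open>Coherence of capital processes\<close>
definition gain ::
    "real \<Rightarrow> real \<Rightarrow> real \<Rightarrow> real \<Rightarrow> real \<Rightarrow> real \<Rightarrow> counting_path \<Rightarrow> real" where
  "gain lo hi u l a b \<omega> =
     u * (real (N b \<omega>) - real (N a \<omega>) - hi * (b - a)) +
     l * (lo * (b - a) - real (N b \<omega>) + real (N a \<omega>))"

lemma gain_same [simp]: "gain lo hi u l a a \<omega> = 0"
  by (simp add: gain_def)

lemma gain_zero_stakes [simp]: "gain lo hi 0 0 a b \<omega> = 0"
  by (simp add: gain_def)

lemma gain_trans: "gain lo hi u l a b \<omega> + gain lo hi u l b c \<omega> = gain lo hi u l a c \<omega>"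
  by (simp add: gain_def algebra_simps)

definition phase_gain where
  "phase_gain lo hi \<tau> h_up h_lo k t \<omega> =
     gain lo hi (the (h_up k \<omega>)) (the (h_lo k \<omega>))
       (stop_at (\<tau> k) t \<omega>) (stop_at (\<tau> (k+1)) t \<omega>) \<omega>"

text \<open>When the two stopped times of a phase coincide, both sides are zero: a gain over an empty
  interval vanishes, whatever values \<open>the\<close> returns for undefined stakes.\<close>
lemma capital_eq_sum_phase_gain:
  "capital lo hi n \<tau> h_up h_lo c t \<omega> = c + (\<Sum>k=1..n. phase_gain lo hi \<tau> h_up h_lo k t \<omega>)"
  unfolding capital_def phase_gain_def gain_def Let_def
  by (intro arg_cong[of _ _ "(+) c"] sum.cong) auto

lemma strategy_times_mono:
  assumes ts: "trading_strategy n \<tau> h_up h_lo" and "1 \<le> i" "i \<le> j" "j \<le> n + 1"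
  shows "\<tau> i \<omega> \<le> \<tau> j \<omega>"
  using \<open>i \<le> j\<close> \<open>j \<le> n + 1\<close>
proof (induction j rule: dec_induct)
  case (step m)
  then have "\<tau> m \<omega> \<le> \<tau> (m + 1) \<omega>" using ts \<open>1 \<le> i\<close> by (auto simp: trading_strategy_def)
  with step show ?case by (auto intro: order_trans)
qed simp

text \<open>The value \<open>\<sigma> \<and> t\<close> is known from the path up to \<open>\<sigma> \<and> t\<close>: a path that agrees
  with \<open>\<omega>\<close> that long and stops before that moment would force \<open>\<omega>\<close> to stop together with it.\<close>
lemma stop_at_agree:
  assumes \<sigma>: "stopping_time \<sigma>" and ag: "agree_upto T \<omega> \<omega>'"
    and le: "min (\<sigma> \<omega>) (ereal t) \<le> T"
  shows "stop_at \<sigma> t \<omega>' = stop_at \<sigma> t \<omega>"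
proof (cases "\<sigma> \<omega> \<le> T")
  case True
  then have "\<sigma> \<omega> = \<sigma> \<omega>'" using \<sigma> agree_le[OF ag] by (auto simp: stopping_time_def)
  then show ?thesis by (simp add: stop_at_def)
next
  case False
  then have t: "ereal t \<le> T" "T < \<sigma> \<omega>" using le by (auto simp: min_def split: if_splits)
  have "ereal t \<le> \<sigma> \<omega>'"
  proof (rule ccontr)
    assume "\<not> ereal t \<le> \<sigma> \<omega>'"
    then have "\<sigma> \<omega>' < ereal t" by simp
    then have "agree_upto (\<sigma> \<omega>') \<omega>' \<omega>" using t agree_le[OF agree_sym[OF ag], of "\<sigma> \<omega>'"] by simp
    then have "\<sigma> \<omega>' = \<sigma> \<omega>" using \<sigma> by (auto simp: stopping_time_def)
    then show False using t \<open>\<sigma> \<omega>' < ereal t\<close> by simp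
  qed
  then show ?thesis using t by (simp add: stop_at_def min_absorb2)
qed

lemma stop_at_le: "stopping_time \<sigma> \<Longrightarrow> ereal (stop_at \<sigma> t \<omega>) = min (\<sigma> \<omega>) (ereal t)"
  by (cases "\<sigma> \<omega>") (auto simp: stop_at_def stopping_time_def min_def)

lemma stake_agree:
  assumes "stake \<sigma> h" "stopping_time \<sigma>" and "\<sigma> \<omega> < \<infinity>" and ag: "agree_upto (\<sigma> \<omega>) \<omega> \<omega>'"
  shows "h \<omega>' = h \<omega>"
proof -
  have "\<sigma> \<omega> = \<sigma> \<omega>'" using assms by (simp add: stopping_time_def)
  then have "\<omega> \<in> {\<omega>. \<sigma> \<omega> < \<infinity>}" "\<omega>' \<in> {\<omega>. \<sigma> \<omega> < \<infinity>}" using assms(3) by auto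
  then have "\<omega> \<in> dom h" "\<omega>' \<in> dom h" using assms(1) unfolding stake_def by blast+
  then show ?thesis using assms unfolding stake_def measurable_upto_def by metis
qed

lemma phase_gain_agree:
  assumes ts: "trading_strategy n \<tau> h_up h_lo" and k: "k \<in> {1..n}"
    and ag: "agree_upto T \<omega> \<omega>'" and le: "min (\<tau> (k+1) \<omega>) (ereal t) \<le> T"
  shows "phase_gain lo hi \<tau> h_up h_lo k t \<omega>' = phase_gain lo hi \<tau> h_up h_lo k t \<omega>"
proof -
  have st: "stopping_time (\<tau> k)" "stopping_time (\<tau> (k+1))" "\<tau> k \<omega> \<le> \<tau> (k+1) \<omega>"
    and sk: "stake (\<tau> k) (h_up k)" "stake (\<tau> k) (h_lo k)"
    using ts k by (auto simp: trading_strategy_def)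
  have le': "min (\<tau> k \<omega>) (ereal t) \<le> T"
    using st(3) le by (meson min.mono order.trans order_refl)
  note eq = stop_at_agree[OF st(1) ag le'] stop_at_agree[OF st(2) ag le]
  have NN: "N (stop_at (\<tau> k) t \<omega>) \<omega>' = N (stop_at (\<tau> k) t \<omega>) \<omega>"
    "N (stop_at (\<tau> (k+1)) t \<omega>) \<omega>' = N (stop_at (\<tau> (k+1)) t \<omega>) \<omega>"
    using agree_N[OF ag, symmetric] le le' stop_at_le st by metis+
  show ?thesis
  proof (cases "stop_at (\<tau> k) t \<omega> = stop_at (\<tau> (k+1)) t \<omega>")
    case True
    then show ?thesis using eq by (simp add: phase_gain_def)
  next
    case False
    have lt: "\<tau> k \<omega> < ereal t"
    proof (rule ccontr)
      assume "\<not> \<tau> k \<omega> < ereal t"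
      then have "ereal t \<le> \<tau> k \<omega>" "ereal t \<le> \<tau> (k+1) \<omega>" using st(3) by auto
      then show False using False by (simp add: stop_at_def min_absorb2)
    qed
    then have fin: "\<tau> k \<omega> < \<infinity>" and "\<tau> k \<omega> \<le> T" using le' by (auto simp: min_absorb1)
    then have ag': "agree_upto (\<tau> k \<omega>) \<omega> \<omega>'" using agree_le[OF ag] by blast
    have "h_up k \<omega>' = h_up k \<omega>" "h_lo k \<omega>' = h_lo k \<omega>"
      by (rule stake_agree[OF sk(1) st(1) fin ag'], rule stake_agree[OF sk(2) st(1) fin ag'])
    then show ?thesis using eq NN by (simp add: phase_gain_def gain_def)
  qed
qed

lemma stake_nonneg: "stake \<sigma> h \<Longrightarrow> \<sigma> \<omega> < \<infinity> \<Longrightarrow> 0 \<le> the (h \<omega>)"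
  unfolding stake_def by (metis (mono_tags, lifting) domD mem_Collect_eq option.sel ranI subsetD)

text \<open>After time \<open>r\<close> there is a future on which fixed stakes gain at most \<open>\<epsilon>\<close>, no matter when the
  position is closed. If the stake on jumps is at least the other one, the future without jumps lets
  the position win nothing, because \<open>lo \<le> hi\<close>. Otherwise jumps at a regular spacing \<open>\<delta>\<close> with
  \<open>lo \<cdot> \<delta> \<le> 1\<close> keep the jump count above \<open>lo\<close> times the elapsed time, except for the
  small shortfall \<open>lo \<cdot> \<delta>\<close> that builds up before the first jump.\<close>
lemma adverse_continuation:
  assumes "0 \<le> lo" "lo \<le> hi" "0 \<le> u" "0 \<le> l" "0 < \<epsilon>" and r: "0 \<le> r"
  obtains \<zeta> where "\<And>\<omega> b. r \<le> b \<Longrightarrow> gain lo hi u l r b (graft \<omega> r \<zeta>) \<le> \<epsilon>"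
proof (cases "l \<le> u")
  case True
  have Z: "N t (Abs_counting_path (\<lambda>_. 0)) = 0" for t
    by (rule N_Abs) (auto simp: mono_def)
  have "gain lo hi u l r b (graft \<omega> r (Abs_counting_path (\<lambda>_. 0))) \<le> \<epsilon>" if "r \<le> b" for \<omega> b
  proof -
    have "l * lo \<le> u * hi" using True assms by (intro mult_mono) auto
    then have "l * lo * (b - r) \<le> u * hi * (b - r)" using that by (intro mult_right_mono) auto
    then show ?thesis using r that \<open>0 < \<epsilon>\<close> by (auto simp: gain_def N_graft Z algebra_simps)
  qed
  then show ?thesis using that by blast
next
  case False
  define \<delta> where "\<delta> = min (1 / (lo + 1)) (\<epsilon> / (lo * l + 1))"
  have pos: "0 < lo + 1" "0 < lo * l + 1" using assms by (auto intro: add_nonneg_pos)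
  then have \<delta>: "0 < \<delta>" using assms by (auto simp: \<delta>_def)
  have "\<delta> \<le> 1 / (lo + 1)" "\<delta> \<le> \<epsilon> / (lo * l + 1)" by (auto simp: \<delta>_def)
  then have "\<delta> * (lo + 1) \<le> 1" "\<delta> * (lo * l + 1) \<le> \<epsilon>"
    using pos by (auto simp: pos_le_divide_eq)
  then have \<delta>1: "lo * \<delta> \<le> 1" and \<delta>2: "l * (lo * \<delta>) \<le> \<epsilon>"
    using \<delta> by (auto simp: algebra_simps)
  obtain J where J: "\<And>s. N s J = nat \<lfloor>(s - r) / \<delta>\<rfloor>" using regular_path[OF r \<delta>] by blast
  have "gain lo hi u l r b (graft \<omega> r J) \<le> \<epsilon>" if b: "r \<le> b" for \<omega> b
  proof -
    define x where "x = (b - r) / \<delta>"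
    define m where "m = real (N b J)"
    have x: "0 \<le> x" "b - r = \<delta> * x" using b \<delta> by (auto simp: x_def)
    have m: "x - 1 \<le> m" "0 \<le> m" unfolding m_def J x_def[symmetric] using x by linarith+
    have "lo * \<delta> * (x - 1) \<le> m"
    proof (cases "x \<le> 1")
      case True
      then have "lo * \<delta> * (x - 1) \<le> 0" using assms \<delta> by (intro mult_nonneg_nonpos) auto
      then show ?thesis using m by linarith
    next
      case False
      then have "lo * \<delta> * (x - 1) \<le> 1 * (x - 1)" using \<delta>1 by (intro mult_right_mono) auto
      then show ?thesis using m by simp
    qed
    then have shortfall: "lo * (b - r) - m \<le> lo * \<delta>" unfolding x by (simp add: algebra_simps)
    have "N r J = 0" by (simp add: J)
    then have "gain lo hi u l r b (graft \<omega> r J) = u * (m - hi * (b - r)) + l * (lo * (b - r) - m)"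
      using b r by (auto simp: gain_def N_graft m_def)
    also have "u * (m - hi * (b - r)) \<le> u * (m - lo * (b - r))"
      using assms b by (intro mult_left_mono diff_left_mono mult_right_mono) auto
    finally have "gain lo hi u l r b (graft \<omega> r J) \<le> (l - u) * (lo * (b - r) - m)"
      by (simp add: algebra_simps)
    also have "\<dots> \<le> (l - u) * (lo * \<delta>)" using False shortfall by (intro mult_left_mono) auto
    also have "\<dots> \<le> l * (lo * \<delta>)" using assms \<delta> by (intro mult_right_mono) auto
    finally show ?thesis using \<delta>2 by linarith
  qed
  then show ?thesis using that by blast
qed

text \<open>Nature defeats the strategy phase by phase. When a phase starts, its stakes are settled by the
  path so far, so everything after that moment (or after \<open>s\<close>, if this is later) can be replaced by
  an adverse continuation; what was achieved against the earlier phases is not disturbed. If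
  a phase never starts, the path found so far already serves for all later phases.\<close>
lemma adverse_path:
  assumes lohi: "0 \<le> lo" "lo \<le> hi" and ts: "trading_strategy n \<tau> h_up h_lo"
    and s: "0 \<le> s" and \<epsilon>: "0 < \<epsilon>" and "j \<le> n"
  shows "\<exists>\<omega>'. agree_upto (ereal s) \<omega> \<omega>' \<and>
    (\<forall>t\<ge>s. (\<Sum>k=1..j. phase_gain lo hi \<tau> h_up h_lo k t \<omega>')
         \<le> (\<Sum>k=1..j. phase_gain lo hi \<tau> h_up h_lo k s \<omega>) + real j * \<epsilon>)"
  using \<open>j \<le> n\<close>
proof (induction j)
  case 0
  show ?case by (intro exI[of _ \<omega>]) (simp add: agree_refl)
next
  case (Suc j)
  let ?P = "phase_gain lo hi \<tau> h_up h_lo"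
  from Suc obtain \<omega>1 where ag1: "agree_upto (ereal s) \<omega> \<omega>1"
    and le1: "\<And>t. s \<le> t \<Longrightarrow> (\<Sum>k=1..j. ?P k t \<omega>1) \<le> (\<Sum>k=1..j. ?P k s \<omega>) + real j * \<epsilon>"
    by auto
  let ?k = "Suc j"
  have k: "?k \<in> {1..n}" using Suc.prems by simp
  have st: "stopping_time (\<tau> ?k)" "stopping_time (\<tau> (?k+1))" "\<And>\<omega>. \<tau> ?k \<omega> \<le> \<tau> (?k+1) \<omega>"
    and sk: "stake (\<tau> ?k) (h_up ?k)" "stake (\<tau> ?k) (h_lo ?k)"
    using ts k by (auto simp: trading_strategy_def)
  have "\<exists>\<omega>2. agree_upto (ereal s) \<omega>1 \<omega>2 \<and> (\<forall>t i. i \<in> {1..j} \<longrightarrow> ?P i t \<omega>2 = ?P i t \<omega>1) \<and>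
     (\<forall>t\<ge>s. ?P ?k t \<omega>2 \<le> ?P ?k s \<omega>2 + \<epsilon>)"
  proof (cases "\<tau> ?k \<omega>1")
    case PInf
    then have "\<tau> (?k+1) \<omega>1 = \<infinity>" using st(3)[of \<omega>1] by simp
    with PInf have "?P ?k t \<omega>1 = 0" for t by (simp add: phase_gain_def stop_at_def)
    then show ?thesis using \<epsilon> by (intro exI[of _ \<omega>1]) (auto simp: agree_refl)
  next
    case MInf
    then show ?thesis using st by (auto simp: stopping_time_def dest: spec[of _ \<omega>1])
  next
    case (real p)
    define r where "r = max s p"
    have r: "0 \<le> r" "s \<le> r" "p \<le> r" using s by (auto simp: r_def)
    define u l where "u = the (h_up ?k \<omega>1)" and "l = the (h_lo ?k \<omega>1)"
    have ul: "0 \<le> u" "0 \<le> l" using stake_nonneg[OF sk(1), of \<omega>1] stake_nonneg[OF sk(2), of \<omega>1] real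
      by (auto simp: u_def l_def)
    obtain \<zeta> where \<zeta>: "\<And>\<omega> b. r \<le> b \<Longrightarrow> gain lo hi u l r b (graft \<omega> r \<zeta>) \<le> \<epsilon>"
      using adverse_continuation[OF lohi ul \<epsilon> r(1)] by blast
    define \<omega>2 where "\<omega>2 = graft \<omega>1 r \<zeta>"
    have \<zeta>2: "gain lo hi u l r b \<omega>2 \<le> \<epsilon>" if "r \<le> b" for b
      unfolding \<omega>2_def using that by (rule \<zeta>)
    have ag2: "agree_upto (ereal r) \<omega>1 \<omega>2" unfolding \<omega>2_def by (rule agree_graft) (auto simp: r)
    have agp: "agree_upto (\<tau> ?k \<omega>1) \<omega>1 \<omega>2" by (rule agree_le[OF ag2]) (simp add: real r)
    then have p2: "\<tau> ?k \<omega>2 = ereal p" using st(1) real unfolding stopping_time_def by metis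
    have fin: "\<tau> ?k \<omega>1 < \<infinity>" by (simp add: real)
    have h2: "h_up ?k \<omega>2 = h_up ?k \<omega>1" "h_lo ?k \<omega>2 = h_lo ?k \<omega>1"
      by (rule stake_agree[OF sk(1) st(1) fin agp], rule stake_agree[OF sk(2) st(1) fin agp])
    have "?P i t \<omega>2 = ?P i t \<omega>1" if i: "i \<in> {1..j}" for i t
    proof (rule phase_gain_agree[OF ts _ ag2])
      show "i \<in> {1..n}" using i k by auto
      have "\<tau> (i+1) \<omega>1 \<le> \<tau> ?k \<omega>1"
        using i k by (intro strategy_times_mono[OF ts]) auto
      then show "min (\<tau> (i+1) \<omega>1) (ereal t) \<le> ereal r" 
        using real r by (metis ereal_less_eq(3) min.coboundedI1 order_trans)
    qed
    moreover have "?P ?k t \<omega>2 \<le> ?P ?k s \<omega>2 + \<epsilon>" if t: "s \<le> t" for t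
    proof -
      define q where "q = \<tau> (?k+1) \<omega>2"
      have q: "ereal p \<le> q" using st(3)[of \<omega>2] p2 by (simp add: q_def)
      define b where "b = (\<lambda>t. real_of_ereal (min q (ereal t)))"
      have P: "?P ?k t \<omega>2 = gain lo hi u l (min p t) (b t) \<omega>2" for t
        by (simp only: phase_gain_def stop_at_def p2 h2 u_def l_def q_def b_def
            ereal_min[symmetric] real_of_ereal.simps)
      have b: "(\<forall>t. b t = t) \<or> (\<exists>x\<ge>p. \<forall>t. b t = min x t)"
        using q by (cases q) (auto simp: b_def simp flip: ereal_min)
      show ?thesis
      proof (cases "p \<le> s")
        case True
        then have "r = s" "min p t = p" "min p s = p" using t by (auto simp: r_def)
        moreover have "b t = b s \<and> b t \<le> s \<or> b s = s \<and> s \<le> b t" using b t by fastforce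
        ultimately show ?thesis
          using gain_trans[of lo hi u l p s \<omega>2 "b t"] \<zeta>2[of "b t"] \<epsilon>
          by (auto simp: P)
      next
        case False
        then have "r = p" "min p s = s" "b s = s" using b by (auto simp: r_def)
        moreover have "b t = min p t \<or> p \<le> b t \<and> min p t = p" using b t by fastforce
        ultimately show ?thesis
          using \<zeta>2[of "b t"] \<epsilon> by (auto simp: P)
      qed
    qed
    moreover have "agree_upto (ereal s) \<omega>1 \<omega>2" by (rule agree_le[OF ag2]) (simp add: r)
    ultimately show ?thesis by blast
  qed
  then obtain \<omega>2 where ag2: "agree_upto (ereal s) \<omega>1 \<omega>2"
    and old: "\<And>t i. i \<in> {1..j} \<Longrightarrow> ?P i t \<omega>2 = ?P i t \<omega>1"
    and new: "\<And>t. s \<le> t \<Longrightarrow> ?P ?k t \<omega>2 \<le> ?P ?k s \<omega>2 + \<epsilon>" by blast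
  have ag: "agree_upto (ereal s) \<omega> \<omega>2" using ag1 ag2 by (rule agree_trans)
  have "?P ?k s \<omega>2 = ?P ?k s \<omega>" by (rule phase_gain_agree[OF ts k ag]) simp
  have "(\<Sum>k=1..?k. ?P k t \<omega>2) \<le> (\<Sum>k=1..?k. ?P k s \<omega>) + real ?k * \<epsilon>" if "s \<le> t" for t
  proof -
    have "(\<Sum>k=1..j. ?P k t \<omega>2) = (\<Sum>k=1..j. ?P k t \<omega>1)" by (intro sum.cong refl old)
    then have "(\<Sum>k=1..?k. ?P k t \<omega>2) = (\<Sum>k=1..j. ?P k t \<omega>1) + ?P ?k t \<omega>2" by simp
    moreover have "(\<Sum>k=1..?k. ?P k s \<omega>) = (\<Sum>k=1..j. ?P k s \<omega>) + ?P ?k s \<omega>" by simp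
    moreover have "real ?k * \<epsilon> = real j * \<epsilon> + \<epsilon>" by (simp add: algebra_simps)
    ultimately show ?thesis using le1[OF that] new[OF that] \<open>?P ?k s \<omega>2 = ?P ?k s \<omega>\<close> by linarith
  qed
  then show ?case using ag by blast
qed

text \<open>Coherence: a capital process that ends above \<open>c\<close> on all continuations of a path already has
  capital \<open>c\<close>, as otherwise an adverse path would end below \<open>c\<close>.\<close>
lemma capital_ge_of_Liminf_ge:
  assumes "0 \<le> lo" "lo \<le> hi" and K: "K \<in> capital_processes lo hi" and s: "0 \<le> s"
    and lim: "\<And>\<omega>'. agree_upto (ereal s) \<omega> \<omega>' \<Longrightarrow> c \<le> Liminf at_top (\<lambda>t. ereal (K t \<omega>'))"
  shows "c \<le> ereal (K s \<omega>)"
proof -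
  obtain n \<tau> h_up h_lo c0 where K_def: "K = capital lo hi n \<tau> h_up h_lo c0"
    and ts: "trading_strategy n \<tau> h_up h_lo"
    using K by (auto simp: capital_processes_def)
  have "c \<le> ereal (K s \<omega> + \<epsilon>)" if \<epsilon>: "0 < \<epsilon>" for \<epsilon>
  proof -
    have n: "1 \<le> n" using ts by (simp add: trading_strategy_def)
    then have "0 < \<epsilon> / real n" using \<epsilon> by simp
    from adverse_path[OF assms(1,2) ts s this order_refl, of \<omega>] obtain \<omega>'
      where ag: "agree_upto (ereal s) \<omega> \<omega>'"
        and "\<And>t. s \<le> t \<Longrightarrow> (\<Sum>k=1..n. phase_gain lo hi \<tau> h_up h_lo k t \<omega>')
          \<le> (\<Sum>k=1..n. phase_gain lo hi \<tau> h_up h_lo k s \<omega>) + real n * (\<epsilon> / real n)"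
      by blast
    then have le: "K t \<omega>' \<le> K s \<omega> + \<epsilon>" if "s \<le> t" for t
      using that n by (simp add: K_def capital_eq_sum_phase_gain)
    have "c \<le> Liminf at_top (\<lambda>t. ereal (K t \<omega>'))" by (rule lim[OF ag])
    also have "\<dots> \<le> Limsup at_top (\<lambda>t. ereal (K t \<omega>'))" by (rule Liminf_le_Limsup) simp
    also have "\<dots> \<le> ereal (K s \<omega> + \<epsilon>)"
      using le by (intro Limsup_bounded) (auto simp: eventually_at_top_linorder)
    finally show ?thesis .
  qed
  then have "c \<le> ereal (K s \<omega>) + ereal \<epsilon>" if "0 < \<epsilon>" for \<epsilon>
    using that by (metis plus_ereal.simps(1))
  then show ?thesis by (rule ereal_le_epsilon2)
qed

section \<open>Strategies on a bounded time interval\<close>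

text \<open>Measurability with respect to a stopping time with real values. Taking \<open>h = \<sigma>\<close> says that
  \<open>\<sigma>\<close> is a stopping time.\<close>
definition adapted :: "(counting_path \<Rightarrow> real) \<Rightarrow> (counting_path \<Rightarrow> 'a) \<Rightarrow> bool" where
  "adapted \<sigma> h \<longleftrightarrow> (\<forall>\<omega>\<^sub>1 \<omega>\<^sub>2. agree_upto (ereal (\<sigma> \<omega>\<^sub>1)) \<omega>\<^sub>1 \<omega>\<^sub>2 \<longrightarrow> h \<omega>\<^sub>1 = h \<omega>\<^sub>2)"

lemma adaptedD: "adapted \<sigma> h \<Longrightarrow> agree_upto (ereal (\<sigma> \<omega>\<^sub>1)) \<omega>\<^sub>1 \<omega>\<^sub>2 \<Longrightarrow> h \<omega>\<^sub>1 = h \<omega>\<^sub>2"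
  by (simp add: adapted_def)

text \<open>A trading strategy confined to \<open>[a, b]\<close> with exactly \<open>n\<close> phases and stakes bounded by \<open>B\<close>. The
  number of phases and the bound are parameters because infinitely many strategies can be
  combined into a single one only under a common bound on both. The times start at \<open>a\<close>
  and end at \<open>b\<close> so that strategies on adjacent intervals can be joined and a constant stake
  can be added on the whole interval.\<close>
definition plan ::
    "real \<Rightarrow> real \<Rightarrow> nat \<Rightarrow> real \<Rightarrow> (nat \<Rightarrow> counting_path \<Rightarrow> real) \<Rightarrow>
     (nat \<Rightarrow> counting_path \<Rightarrow> real) \<Rightarrow> (nat \<Rightarrow> counting_path \<Rightarrow> real) \<Rightarrow> bool" where
  "plan a b n B \<tau> u l \<longleftrightarrow> 0 \<le> B \<and>
     (\<forall>\<omega>. \<tau> 0 \<omega> = a \<and> \<tau> n \<omega> = b) \<and> (\<forall>k\<le>n. adapted (\<tau> k) (\<tau> k)) \<and>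
     (\<forall>k<n. (\<forall>\<omega>. \<tau> k \<omega> \<le> \<tau> (Suc k) \<omega>) \<and>
        adapted (\<tau> k) (u k) \<and> adapted (\<tau> k) (l k) \<and>
        (\<forall>\<omega>. u k \<omega> \<in> {0..B} \<and> l k \<omega> \<in> {0..B}))"

definition plan_gain ::
    "real \<Rightarrow> real \<Rightarrow> nat \<Rightarrow> (nat \<Rightarrow> counting_path \<Rightarrow> real) \<Rightarrow> (nat \<Rightarrow> counting_path \<Rightarrow> real) \<Rightarrow>
     (nat \<Rightarrow> counting_path \<Rightarrow> real) \<Rightarrow> real \<Rightarrow> counting_path \<Rightarrow> real" where
  "plan_gain lo hi n \<tau> u l t \<omega> =
     (\<Sum>k<n. gain lo hi (u k \<omega>) (l k \<omega>) (min (\<tau> k \<omega>) t) (min (\<tau> (Suc k) \<omega>) t) \<omega>)"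

definition gains ::
    "real \<Rightarrow> real \<Rightarrow> real \<Rightarrow> real \<Rightarrow> nat \<Rightarrow> real \<Rightarrow> (real \<Rightarrow> counting_path \<Rightarrow> real) set" where
  "gains lo hi a b n B = {plan_gain lo hi n \<tau> u l | \<tau> u l. plan a b n B \<tau> u l}"

lemma gainsE:
  assumes "G \<in> gains lo hi a b n B"
  obtains \<tau> u l where "plan a b n B \<tau> u l" "G = plan_gain lo hi n \<tau> u l"
  using assms by (auto simp: gains_def)

lemma gainsI: "plan a b n B \<tau> u l \<Longrightarrow> G = plan_gain lo hi n \<tau> u l \<Longrightarrow> G \<in> gains lo hi a b n B"
  by (auto simp: gains_def)

lemma plan_times_mono:
  assumes "plan a b n B \<tau> u l" "i \<le> j" "j \<le> n"
  shows "\<tau> i \<omega> \<le> \<tau> j \<omega>"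
  using assms(2,3)
proof (induction j rule: dec_induct)
  case (step m)
  then have "\<tau> m \<omega> \<le> \<tau> (Suc m) \<omega>" using assms(1) by (auto simp: plan_def)
  with step show ?case by simp
qed simp

lemma plan_times_bounds:
  assumes "plan a b n B \<tau> u l" "k \<le> n"
  shows "a \<le> \<tau> k \<omega>" "\<tau> k \<omega> \<le> b"
  using plan_times_mono[OF assms(1), of 0 k \<omega>] plan_times_mono[OF assms(1), of k n \<omega>] assms
  by (auto simp: plan_def)

lemma gains_before:
  assumes "G \<in> gains lo hi a b n B" "t \<le> a"
  shows "G t \<omega> = 0"
proof -
  obtain \<tau> u l where p: "plan a b n B \<tau> u l" and G: "G = plan_gain lo hi n \<tau> u l"
    using assms(1) by (rule gainsE)
  have "min (\<tau> k \<omega>) t = t" if "k \<le> n" for k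
    using plan_times_bounds[OF p that, of \<omega>] assms(2) by simp
  then show ?thesis unfolding G plan_gain_def by (intro sum.neutral) simp
qed

lemma gains_after:
  assumes "G \<in> gains lo hi a b n B" "b \<le> t"
  shows "G t \<omega> = G b \<omega>"
proof -
  obtain \<tau> u l where p: "plan a b n B \<tau> u l" and G: "G = plan_gain lo hi n \<tau> u l"
    using assms(1) by (rule gainsE)
  have "min (\<tau> k \<omega>) t = \<tau> k \<omega>" "min (\<tau> k \<omega>) b = \<tau> k \<omega>" if "k \<le> n" for k
    using plan_times_bounds[OF p that, of \<omega>] assms(2) by auto
  then show ?thesis unfolding G plan_gain_def by (intro sum.cong) auto
qed

lemma gains_zero:
  assumes "a \<le> b" "0 \<le> B" "0 < n"
  shows "(\<lambda>_ _. 0) \<in> gains lo hi a b n B"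
proof (rule gainsI)
  show "plan a b n B (\<lambda>k _. if k = 0 then a else b) (\<lambda>_ _. 0) (\<lambda>_ _. 0)"
    using assms by (auto simp: plan_def adapted_def)
qed (simp add: plan_gain_def fun_eq_iff)

text \<open>Further phases of length zero, all at time \<open>b\<close>, change nothing.\<close>
lemma gains_pad:
  assumes "G \<in> gains lo hi a b n B" "n \<le> n'" "B \<le> B'"
  shows "G \<in> gains lo hi a b n' B'"
proof -
  obtain \<tau> u l where p: "plan a b n B \<tau> u l" and G: "G = plan_gain lo hi n \<tau> u l"
    using assms(1) by (rule gainsE)
  let ?\<tau> = "\<lambda>k. \<tau> (min k n)" and ?u = "\<lambda>k. if k < n then u k else (\<lambda>_. 0)"
    and ?l = "\<lambda>k. if k < n then l k else (\<lambda>_. 0)"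
  show ?thesis
  proof (rule gainsI)
    have "\<tau> (min k n) \<omega> \<le> \<tau> (min (Suc k) n) \<omega>" for k \<omega>
      by (rule plan_times_mono[OF p]) auto
    moreover have "0 \<le> u k \<omega> \<and> u k \<omega> \<le> B'" "0 \<le> l k \<omega> \<and> l k \<omega> \<le> B'" if "k < n" for k \<omega>
      using p that \<open>B \<le> B'\<close> unfolding plan_def by (meson atLeastAtMost_iff order_trans)+
    moreover have "0 \<le> B'" "\<tau> 0 \<omega> = a" "\<tau> n \<omega> = b" for \<omega>
      using p \<open>B \<le> B'\<close> by (auto simp: plan_def)
    moreover have "adapted (\<tau> k) (\<tau> k)" if "k \<le> n" for k using p that by (simp add: plan_def)
    moreover have "adapted (\<tau> k) (u k)" "adapted (\<tau> k) (l k)" if "k < n" for k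
      using p that by (simp_all add: plan_def)
    moreover have "adapted \<sigma> (\<lambda>_. 0 :: real)" for \<sigma> by (simp add: adapted_def)
    ultimately show "plan a b n' B' ?\<tau> ?u ?l"
      using \<open>n \<le> n'\<close> by (simp add: plan_def split: if_split)
    show "G = plan_gain lo hi n' ?\<tau> ?u ?l"
      unfolding G plan_gain_def fun_eq_iff
      using \<open>n \<le> n'\<close> by (intro allI sum.mono_neutral_cong_left) auto
  qed
qed

text \<open>A strategy on \<open>[a, b]\<close> may be chosen according to the path up to time \<open>a\<close>, since all of its
  times are at least \<open>a\<close> and hence know the choice. The number of phases and the bound on the
  stakes must not depend on the choice.\<close>
lemma gains_choice:
  assumes S: "\<And>\<omega>. S \<omega> \<in> gains lo hi a b n B" and "0 \<le> B"
    and ad: "\<And>\<omega>\<^sub>1 \<omega>\<^sub>2. agree_upto (ereal a) \<omega>\<^sub>1 \<omega>\<^sub>2 \<Longrightarrow> S \<omega>\<^sub>1 = S \<omega>\<^sub>2"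
  shows "(\<lambda>t \<omega>. S \<omega> t \<omega>) \<in> gains lo hi a b n B"
proof -
  have "\<forall>G\<in>gains lo hi a b n B. \<exists>p. plan a b n B (fst p) (fst (snd p)) (snd (snd p)) \<and>
      G = plan_gain lo hi n (fst p) (fst (snd p)) (snd (snd p))"
    by (auto simp: gains_def)
  then obtain c where c: "\<And>G. G \<in> gains lo hi a b n B \<Longrightarrow>
      plan a b n B (fst (c G)) (fst (snd (c G))) (snd (snd (c G))) \<and>
      G = plan_gain lo hi n (fst (c G)) (fst (snd (c G))) (snd (snd (c G)))"
    by metis
  define T U L where "T G = fst (c G)" and "U G = fst (snd (c G))" and "L G = snd (snd (c G))" for G
  have p: "plan a b n B (T (S \<omega>)) (U (S \<omega>)) (L (S \<omega>))"
    and S_eq: "S \<omega> = plan_gain lo hi n (T (S \<omega>)) (U (S \<omega>)) (L (S \<omega>))" for \<omega>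
    using c[OF S[of \<omega>]] by (simp_all add: T_def U_def L_def)
  have same: "S \<omega>\<^sub>1 = S \<omega>\<^sub>2" if "k \<le> n" "agree_upto (ereal (T (S \<omega>\<^sub>1) k \<omega>\<^sub>1)) \<omega>\<^sub>1 \<omega>\<^sub>2" for k \<omega>\<^sub>1 \<omega>\<^sub>2
    by (rule ad, rule agree_le[OF that(2)]) (use plan_times_bounds[OF p that(1)] in simp)
  have ad': "adapted (\<lambda>\<omega>. T (S \<omega>) k \<omega>) (\<lambda>\<omega>. h (S \<omega>) \<omega>)"
    if "k \<le> n" "\<And>\<omega>. adapted (T (S \<omega>) k) (h (S \<omega>))" for k and h :: "_ \<Rightarrow> counting_path \<Rightarrow> real"
    unfolding adapted_def using same[OF that(1)] adaptedD[OF that(2)] by metis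
  show ?thesis
  proof (rule gainsI)
    show "plan a b n B (\<lambda>k \<omega>. T (S \<omega>) k \<omega>) (\<lambda>k \<omega>. U (S \<omega>) k \<omega>) (\<lambda>k \<omega>. L (S \<omega>) k \<omega>)"
      unfolding plan_def
    proof (intro conjI allI impI)
      show "adapted (\<lambda>\<omega>. T (S \<omega>) k \<omega>) (\<lambda>\<omega>. T (S \<omega>) k \<omega>)" if "k \<le> n" for k
        by (rule ad'[of k "\<lambda>G. T G k"]) (use p that in \<open>auto simp: plan_def\<close>)
      show "adapted (\<lambda>\<omega>. T (S \<omega>) k \<omega>) (\<lambda>\<omega>. U (S \<omega>) k \<omega>)" if "k < n" for k
        by (rule ad'[of k "\<lambda>G. U G k"]) (use p that in \<open>auto simp: plan_def\<close>)
      show "adapted (\<lambda>\<omega>. T (S \<omega>) k \<omega>) (\<lambda>\<omega>. L (S \<omega>) k \<omega>)" if "k < n" for k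
        by (rule ad'[of k "\<lambda>G. L G k"]) (use p that in \<open>auto simp: plan_def\<close>)
    qed (use p \<open>0 \<le> B\<close> in \<open>auto simp: plan_def\<close>)
    show "(\<lambda>t \<omega>. S \<omega> t \<omega>) =
        plan_gain lo hi n (\<lambda>k \<omega>. T (S \<omega>) k \<omega>) (\<lambda>k \<omega>. U (S \<omega>) k \<omega>) (\<lambda>k \<omega>. L (S \<omega>) k \<omega>)"
    proof (intro ext)
      fix t \<omega>
      have "S \<omega> t \<omega> = plan_gain lo hi n (T (S \<omega>)) (U (S \<omega>)) (L (S \<omega>)) t \<omega>"
        using S_eq[of \<omega>] by (rule fun_cong[OF fun_cong])
      then show "S \<omega> t \<omega> = plan_gain lo hi n (\<lambda>k \<omega>. T (S \<omega>) k \<omega>) (\<lambda>k \<omega>. U (S \<omega>) k \<omega>)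
          (\<lambda>k \<omega>. L (S \<omega>) k \<omega>) t \<omega>"
        by (simp add: plan_gain_def)
    qed
  qed
qed

text \<open>The last time \<open>b\<close> of the first strategy is the first time of the second one, so the two lists of
  phases join without a gap.\<close>
lemma gains_concat:
  assumes "G \<in> gains lo hi a b n B" and "F \<in> gains lo hi b c m B"
  shows "(\<lambda>t \<omega>. G t \<omega> + F t \<omega>) \<in> gains lo hi a c (n + m) B"
proof -
  obtain \<tau> u l where p: "plan a b n B \<tau> u l" and G: "G = plan_gain lo hi n \<tau> u l"
    using assms(1) by (rule gainsE)
  obtain \<tau>' u' l' where p': "plan b c m B \<tau>' u' l'" and F: "F = plan_gain lo hi m \<tau>' u' l'"
    using assms(2) by (rule gainsE)
  define T U L where "T k = (if k \<le> n then \<tau> k else \<tau>' (k - n))"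
    and "U k = (if k < n then u k else u' (k - n))"
    and "L k = (if k < n then l k else l' (k - n))" for k
  have early: "T k = \<tau> k" "T (Suc k) = \<tau> (Suc k)" "U k = u k" "L k = l k" if "k < n" for k
    using that by (auto simp: T_def U_def L_def)
  have junction: "\<tau> n = \<tau>' 0" using p p' by (auto simp: plan_def)
  have late: "T (n + k) = \<tau>' k" "T (Suc (n + k)) = \<tau>' (Suc k)" "U (n + k) = u' k" "L (n + k) = l' k" for k
    using junction by (auto simp: T_def U_def L_def)
  have cases: "P k" if "\<And>k. k < n \<Longrightarrow> P k" "\<And>k. k < m \<Longrightarrow> P (n + k)" "k < n + m" for P k
    using that(1)[of k] that(2)[of "k - n"] that(3) by (cases "k < n") auto
  show ?thesis
  proof (rule gainsI)
    show "plan a c (n + m) B T U L"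
      unfolding plan_def
    proof (intro conjI allI impI)
      show "0 \<le> B" using p by (simp add: plan_def)
      show "T 0 \<omega> = a" for \<omega> using p by (simp add: plan_def T_def)
      show "T (n + m) \<omega> = c" for \<omega> using p' by (simp add: plan_def late)
      show "adapted (T k) (T k)" if "k \<le> n + m" for k
        using p p' that by (auto simp: plan_def T_def)
      show "T k \<omega> \<le> T (Suc k) \<omega>" if "k < n + m" for k \<omega>
        by (rule cases[OF _ _ that]) (use p p' in \<open>auto simp: plan_def early late\<close>)
      show "adapted (T k) (U k)" if "k < n + m" for k
        by (rule cases[OF _ _ that]) (use p p' in \<open>auto simp: plan_def early late\<close>)
      show "adapted (T k) (L k)" if "k < n + m" for k
        by (rule cases[OF _ _ that]) (use p p' in \<open>auto simp: plan_def early late\<close>)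
      show "U k \<omega> \<in> {0..B}" if "k < n + m" for k \<omega>
        by (rule cases[OF _ _ that]) (use p p' in \<open>auto simp: plan_def early late\<close>)
      show "L k \<omega> \<in> {0..B}" if "k < n + m" for k \<omega>
        by (rule cases[OF _ _ that]) (use p p' in \<open>auto simp: plan_def early late\<close>)
    qed
    have split: "(\<Sum>k<n + m. f k) = (\<Sum>k<n. f k) + (\<Sum>k<m. f (n + k))" for f :: "nat \<Rightarrow> real"
      by (induction m) (simp_all add: add.assoc)
    show "(\<lambda>t \<omega>. G t \<omega> + F t \<omega>) = plan_gain lo hi (n + m) T U L"
      unfolding G F plan_gain_def fun_eq_iff split
      by (intro allI arg_cong2[of _ _ _ _ "(+)"] sum.cong refl) (auto simp: early late)
  qed
qed

lemma sum_gain_telescope: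
  "(\<Sum>k<n. gain lo hi u l (x k) (x (Suc k)) \<omega>) = gain lo hi u l (x 0) (x n) \<omega>"
  by (induction n) (simp_all add: gain_trans)

lemma gains_add_up_stake:
  assumes "G \<in> gains lo hi a b n B" "0 \<le> v"
  shows "(\<lambda>t \<omega>. G t \<omega> + gain lo hi v 0 (min a t) (min b t) \<omega>) \<in> gains lo hi a b n (B + v)"
proof -
  obtain \<tau> u l where p: "plan a b n B \<tau> u l" and G: "G = plan_gain lo hi n \<tau> u l"
    using assms(1) by (rule gainsE)
  show ?thesis
  proof (rule gainsI)
    have "0 \<le> u k \<omega> \<and> u k \<omega> \<le> B" "0 \<le> l k \<omega> \<and> l k \<omega> \<le> B" if "k < n" for k \<omega>
      using p that by (auto simp: plan_def)
    moreover have "adapted \<sigma> (\<lambda>\<omega>. h \<omega> + v)" if "adapted \<sigma> h" for \<sigma> h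
      using that unfolding adapted_def by metis
    ultimately show "plan a b n (B + v) \<tau> (\<lambda>k \<omega>. u k \<omega> + v) l"
      using p \<open>0 \<le> v\<close> unfolding plan_def by (auto simp: add_increasing2)
    have add: "gain lo hi (r + v) s x y \<omega> = gain lo hi r s x y \<omega> + gain lo hi v 0 x y \<omega>" for r s x y \<omega>
      by (simp add: gain_def algebra_simps)
    have ends: "\<tau> 0 \<omega> = a" "\<tau> n \<omega> = b" for \<omega> using p by (auto simp: plan_def)
    show "(\<lambda>t \<omega>. G t \<omega> + gain lo hi v 0 (min a t) (min b t) \<omega>) =
        plan_gain lo hi n \<tau> (\<lambda>k \<omega>. u k \<omega> + v) l"
      unfolding G plan_gain_def add sum.distrib
      using sum_gain_telescope[of lo hi v 0 "\<lambda>k. min (\<tau> k _) _" _ n]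
      by (simp add: fun_eq_iff ends)
  qed
qed

lemma N_diff_graft:
  assumes "0 \<le> a" "a \<le> x" "a \<le> y"
  shows "N y (graft \<eta> a \<omega>) - N x (graft \<eta> a \<omega>) = N y \<omega> - N x \<omega>"
  using assms N_mono[of a x \<omega>] N_mono[of a y \<omega>] by (auto simp: N_graft)

lemma gain_graft:
  assumes "0 \<le> a" "a \<le> x" "a \<le> y"
  shows "gain lo hi u l x y (graft \<eta> a \<omega>) = gain lo hi u l x y \<omega>"
proof -
  have eq: "real (N z (graft \<eta> a \<omega>)) = real (N a \<eta>) + (real (N z \<omega>) - real (N a \<omega>))" if "a \<le> z" for z
    using assms(1) that N_mono[OF that, of \<omega>] by (auto simp: N_graft of_nat_diff)
  show ?thesis unfolding gain_def eq[OF assms(2)] eq[OF assms(3)] by (simp add: algebra_simps)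
qed

lemma agree_graft_graft:
  assumes "0 \<le> a" "a \<le> T" and ag: "agree_upto (ereal T) \<omega>\<^sub>1 \<omega>\<^sub>2"
  shows "agree_upto (ereal T) (graft \<eta> a \<omega>\<^sub>1) (graft \<eta> a \<omega>\<^sub>2)"
  using assms agree_N[OF ag, of a] agree_N[OF ag] by (auto simp: agree_upto_def N_graft)

text \<open>A strategy on \<open>[a, b]\<close> can be run on any path as if its past up to \<open>a\<close> had been \<open>\<eta>\<close>: gains
  after \<open>a\<close> depend on increments after \<open>a\<close> only, and these survive grafting.\<close>
lemma gains_graft:
  assumes "G \<in> gains lo hi a b n B" "0 \<le> a"
  shows "(\<lambda>t \<omega>. G t (graft \<eta> a \<omega>)) \<in> gains lo hi a b n B"
proof -
  obtain \<tau> u l where p: "plan a b n B \<tau> u l" and G: "G = plan_gain lo hi n \<tau> u l"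
    using assms(1) by (rule gainsE)
  let ?s = "graft \<eta> a"
  have ad: "adapted (\<lambda>\<omega>. \<tau> k (?s \<omega>)) (\<lambda>\<omega>. h (?s \<omega>))"
    if "k \<le> n" "adapted (\<tau> k) h" for k and h :: "counting_path \<Rightarrow> real"
    unfolding adapted_def
    using adaptedD[OF that(2)] agree_graft_graft[OF assms(2) plan_times_bounds(1)[OF p that(1)]]
    by blast
  show ?thesis
  proof (rule gainsI)
    show "plan a b n B (\<lambda>k \<omega>. \<tau> k (?s \<omega>)) (\<lambda>k \<omega>. u k (?s \<omega>)) (\<lambda>k \<omega>. l k (?s \<omega>))"
      unfolding plan_def
    proof (intro conjI allI impI)
      show "adapted (\<lambda>\<omega>. \<tau> k (?s \<omega>)) (\<lambda>\<omega>. \<tau> k (?s \<omega>))" if "k \<le> n" for k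
        by (rule ad) (use p that in \<open>auto simp: plan_def\<close>)
      show "adapted (\<lambda>\<omega>. \<tau> k (?s \<omega>)) (\<lambda>\<omega>. u k (?s \<omega>))" if "k < n" for k
        by (rule ad) (use p that in \<open>auto simp: plan_def\<close>)
      show "adapted (\<lambda>\<omega>. \<tau> k (?s \<omega>)) (\<lambda>\<omega>. l k (?s \<omega>))" if "k < n" for k
        by (rule ad) (use p that in \<open>auto simp: plan_def\<close>)
    qed (use p in \<open>auto simp: plan_def\<close>)
    show "(\<lambda>t \<omega>. G t (?s \<omega>)) =
        plan_gain lo hi n (\<lambda>k \<omega>. \<tau> k (?s \<omega>)) (\<lambda>k \<omega>. u k (?s \<omega>)) (\<lambda>k \<omega>. l k (?s \<omega>))"
      unfolding G plan_gain_def fun_eq_iff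
    proof (intro allI sum.cong refl)
      fix t \<omega> k assume "k \<in> {..<n}"
      then have k: "k \<le> n" "Suc k \<le> n" by auto
      note bd = plan_times_bounds(1)[OF p k(1), of "?s \<omega>"] plan_times_bounds(1)[OF p k(2), of "?s \<omega>"]
      show "gain lo hi (u k (?s \<omega>)) (l k (?s \<omega>)) (min (\<tau> k (?s \<omega>)) t) (min (\<tau> (Suc k) (?s \<omega>)) t) (?s \<omega>) =
          gain lo hi (u k (?s \<omega>)) (l k (?s \<omega>)) (min (\<tau> k (?s \<omega>)) t) (min (\<tau> (Suc k) (?s \<omega>)) t) \<omega>"
      proof (cases "a \<le> t")
        case True
        then show ?thesis using bd by (intro gain_graft assms) auto
      next
        case False
        then show ?thesis using bd by simp
      qed
    qed
  qed
qed

lemma add_gain_capital_process: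
  assumes "G \<in> gains lo hi a b n B" "0 \<le> a"
  shows "(\<lambda>t \<omega>. c + G t \<omega>) \<in> capital_processes lo hi"
proof -
  have "G \<in> gains lo hi a b (Suc n) B" using assms(1) by (rule gains_pad) auto
  then obtain \<tau> u l where p: "plan a b (Suc n) B \<tau> u l" and G: "G = plan_gain lo hi (Suc n) \<tau> u l"
    by (rule gainsE)
  let ?m = "Suc n"
  let ?\<tau> = "\<lambda>k \<omega>. ereal (\<tau> (k - 1) \<omega>)" and ?u = "\<lambda>k \<omega>. Some (u (k - 1) \<omega>)"
    and ?l = "\<lambda>k \<omega>. Some (l (k - 1) \<omega>)"
  have stk: "stake (\<lambda>\<omega>. ereal (\<sigma> \<omega>)) (\<lambda>\<omega>. Some (h \<omega>))"
    if "adapted \<sigma> h" "\<And>\<omega>. h \<omega> \<in> {0..B}" for \<sigma> h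
  proof -
    have ran: "ran (\<lambda>\<omega>. Some (h \<omega>)) \<subseteq> {0..B}" using that(2) by (auto simp: ran_def)
    then have "bounded (ran (\<lambda>\<omega>. Some (h \<omega>)))" by (rule bounded_subset[OF bounded_closed_interval])
    with ran show ?thesis using that(1)
      by (auto simp: stake_def measurable_upto_def adapted_def)
  qed
  have "trading_strategy ?m ?\<tau> ?u ?l"
    unfolding trading_strategy_def
  proof (intro conjI ballI allI)
    show "stopping_time (?\<tau> k)" if "k \<in> {1..?m + 1}" for k
    proof -
      have k: "k - 1 \<le> ?m" using that by auto
      then have "adapted (\<tau> (k - 1)) (\<tau> (k - 1))" using p by (auto simp: plan_def)
      moreover have "0 \<le> \<tau> (k - 1) \<omega>" for \<omega>
        using plan_times_bounds(1)[OF p k, of \<omega>] assms(2) by simp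
      ultimately show ?thesis by (simp add: stopping_time_def adapted_def)
    qed
    show "?\<tau> k \<omega> \<le> ?\<tau> (k + 1) \<omega>" if "k \<in> {1..?m}" for k \<omega>
      using plan_times_mono[OF p, of "k - 1" k \<omega>] that by auto
    show "stake (?\<tau> k) (?u k)" "stake (?\<tau> k) (?l k)" if "k \<in> {1..?m}" for k
    proof -
      have "k - 1 < ?m" using that by auto
      then show "stake (?\<tau> k) (?u k)" "stake (?\<tau> k) (?l k)"
        using p by (auto simp: plan_def intro!: stk)
    qed
  qed simp
  moreover have "(\<lambda>t \<omega>. c + G t \<omega>) = capital lo hi ?m ?\<tau> ?u ?l c"
  proof (intro ext)
    fix t \<omega>
    have "(\<Sum>k=1..?m. phase_gain lo hi ?\<tau> ?u ?l k t \<omega>) =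
        (\<Sum>k<?m. phase_gain lo hi ?\<tau> ?u ?l (Suc k) t \<omega>)"
      by (rule sum.reindex_bij_witness[of _ Suc "\<lambda>k. k - 1"]) auto
    then show "c + G t \<omega> = capital lo hi ?m ?\<tau> ?u ?l c t \<omega>"
      by (simp only: capital_eq_sum_phase_gain G plan_gain_def)
        (simp add: phase_gain_def stop_at_def flip: ereal_min)
  qed
  ultimately show ?thesis unfolding capital_processes_def by blast
qed

lemma finite_uniform:
  fixes P :: "'a \<Rightarrow> 'b::linorder \<Rightarrow> bool"
  assumes "finite A" and "\<And>x. x \<in> A \<Longrightarrow> \<exists>m. P x m"
    and mono: "\<And>x m m'. P x m \<Longrightarrow> m \<le> m' \<Longrightarrow> P x m'"
  shows "\<exists>m. \<forall>x\<in>A. P x m"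
  using assms(1,2)
proof (induction A rule: finite_induct)
  case (insert x A)
  then obtain m m' where "\<forall>y\<in>A. P y m" "P x m'" by (metis insertI1 insertI2)
  then have "\<forall>y\<in>insert x A. P y (max m m')" using mono by (metis insertE max.cobounded1 max.cobounded2)
  then show ?case by blast
qed auto

lemma capital_agree:
  assumes K: "K \<in> capital_processes lo hi" and ag: "agree_upto (ereal t) \<omega> \<omega>'"
  shows "K t \<omega>' = K t \<omega>"
proof -
  obtain n \<tau> h_up h_lo c where K_def: "K = capital lo hi n \<tau> h_up h_lo c"
    and ts: "trading_strategy n \<tau> h_up h_lo"
    using K by (auto simp: capital_processes_def)
  show ?thesis unfolding K_def capital_eq_sum_phase_gain
    by (intro arg_cong[of _ _ "(+) c"] sum.cong refl phase_gain_agree[OF ts _ ag]) auto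
qed

lemma capital_zero:
  assumes K: "K \<in> capital_processes lo hi"
  obtains c where "\<And>\<omega>. K 0 \<omega> = c"
proof -
  obtain n \<tau> h_up h_lo c where K_def: "K = capital lo hi n \<tau> h_up h_lo c"
    and ts: "trading_strategy n \<tau> h_up h_lo"
    using K by (auto simp: capital_processes_def)
  have "K 0 \<omega> = c" for \<omega>
  proof -
    have "stop_at (\<tau> k) 0 \<omega> = 0" if "k \<in> {1..n+1}" for k
      using ts that by (auto simp: trading_strategy_def stopping_time_def stop_at_def min_absorb2 zero_ereal_def)
    then have "phase_gain lo hi \<tau> h_up h_lo k 0 \<omega> = 0" if "k \<in> {1..n}" for k
      using that by (simp add: phase_gain_def)
    then show ?thesis by (simp add: K_def capital_eq_sum_phase_gain)
  qed
  then show ?thesis by (rule that)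
qed

lemma stop_at_real_or_id:
  assumes "stopping_time \<sigma>"
  shows "(\<forall>t. stop_at \<sigma> t \<omega> = t) \<and> \<sigma> \<omega> = \<infinity> \<or> (\<exists>p. \<sigma> \<omega> = ereal p \<and> (\<forall>t. stop_at \<sigma> t \<omega> = min p t))"
proof (cases "\<sigma> \<omega>")
  case MInf
  then show ?thesis using assms by (metis MInfty_neq_ereal(1) ereal_infty_less_eq(2) stopping_time_def zero_ereal_def)
qed (auto simp: stop_at_def simp flip: ereal_min)

text \<open>The gain of a capital process over \<open>[a, b]\<close> comes from the strategy whose times are moved into
  \<open>[a, b]\<close>, with an idle phase added at either end. Phases that start at \<open>b\<close> or later get stake
  \<open>0\<close>, because their original stakes need not be known at time \<open>b\<close>.\<close>
lemma capital_restrict_gain: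
  assumes K: "K \<in> capital_processes lo hi" and "a \<le> b"
  shows "\<exists>n B. (\<lambda>t \<omega>. K (max a (min b t)) \<omega> - K a \<omega>) \<in> gains lo hi a b n B"
proof -
  obtain n \<tau> h_up h_lo c where K_def: "K = capital lo hi n \<tau> h_up h_lo c"
    and ts: "trading_strategy n \<tau> h_up h_lo"
    using K by (auto simp: capital_processes_def)
  have st: "stopping_time (\<tau> k)" if "k \<in> {1..n+1}" for k using ts that by (auto simp: trading_strategy_def)
  have le: "\<tau> k \<omega> \<le> \<tau> (k+1) \<omega>" if "k \<in> {1..n}" for k \<omega> using ts that by (auto simp: trading_strategy_def)
  have sk: "stake (\<tau> k) (h_up k)" "stake (\<tau> k) (h_lo k)" if "k \<in> {1..n}" for k
    using ts that by (auto simp: trading_strategy_def)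
  define X where "X k t \<omega> = stop_at (\<tau> k) t \<omega>" for k t \<omega>
  define T where "T k \<omega> = (if k = 0 then a else if k \<le> n + 1 then max a (X k b \<omega>) else b)" for k \<omega>
  define active where "active k \<omega> \<longleftrightarrow> k \<in> {1..n} \<and> \<tau> k \<omega> < ereal b" for k \<omega>
  define U where "U k \<omega> = (if active k \<omega> then the (h_up k \<omega>) else 0)" for k \<omega>
  define L where "L k \<omega> = (if active k \<omega> then the (h_lo k \<omega>) else 0)" for k \<omega>
  have X: "(\<forall>t. X k t \<omega> = t) \<and> \<tau> k \<omega> = \<infinity> \<or> (\<exists>p. \<tau> k \<omega> = ereal p \<and> (\<forall>t. X k t \<omega> = min p t))"
    if "k \<in> {1..n+1}" for k \<omega>
    unfolding X_def by (rule stop_at_real_or_id[OF st[OF that]])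
  have stake_le: "\<exists>B. \<forall>\<omega>. active k \<omega> \<longrightarrow> the (h_up k \<omega>) \<le> B \<and> the (h_lo k \<omega>) \<le> B" if k: "k \<in> {1..n}" for k
  proof -
    obtain B1 B2 where B: "\<And>x. x \<in> ran (h_up k) \<Longrightarrow> \<bar>x\<bar> \<le> B1" "\<And>x. x \<in> ran (h_lo k) \<Longrightarrow> \<bar>x\<bar> \<le> B2"
      using sk[OF k] unfolding stake_def bounded_iff real_norm_def by blast
    have "the (h_up k \<omega>) \<le> max B1 B2 \<and> the (h_lo k \<omega>) \<le> max B1 B2" if "active k \<omega>" for \<omega>
    proof -
      have "\<omega> \<in> {\<omega>. \<tau> k \<omega> < \<infinity>}" using that by (auto simp: active_def)
      then have "\<omega> \<in> dom (h_up k)" "\<omega> \<in> dom (h_lo k)" using sk[OF k] unfolding stake_def by blast+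
      then show ?thesis using B by (fastforce intro: ranI)
    qed
    then show ?thesis by blast
  qed
  have "\<exists>B. \<forall>k\<in>{1..n}. \<forall>\<omega>. active k \<omega> \<longrightarrow> the (h_up k \<omega>) \<le> B \<and> the (h_lo k \<omega>) \<le> B"
    by (rule finite_uniform) (use stake_le in \<open>auto intro: order_trans\<close>)
  then obtain B where B: "\<And>k \<omega>. active k \<omega> \<Longrightarrow> the (h_up k \<omega>) \<le> B \<and> the (h_lo k \<omega>) \<le> B"
    unfolding active_def by blast
  have nonneg: "0 \<le> the (h_up k \<omega>)" "0 \<le> the (h_lo k \<omega>)" if "active k \<omega>" for k \<omega>
  proof -
    have "k \<in> {1..n}" "\<tau> k \<omega> < \<infinity>" using that by (auto simp: active_def)
    then show "0 \<le> the (h_up k \<omega>)" "0 \<le> the (h_lo k \<omega>)" using sk stake_nonneg by blast+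
  qed
  have active_agree: "active k \<omega>\<^sub>2 = active k \<omega>\<^sub>1 \<and> (active k \<omega>\<^sub>1 \<longrightarrow> h_up k \<omega>\<^sub>2 = h_up k \<omega>\<^sub>1 \<and> h_lo k \<omega>\<^sub>2 = h_lo k \<omega>\<^sub>1)"
    if k: "k \<in> {1..n}" and ag: "agree_upto (ereal (T k \<omega>\<^sub>1)) \<omega>\<^sub>1 \<omega>\<^sub>2" for k \<omega>\<^sub>1 \<omega>\<^sub>2
  proof -
    have k': "k \<in> {1..n+1}" "T k \<omega>\<^sub>1 = max a (X k b \<omega>\<^sub>1)" using k by (auto simp: T_def)
    show ?thesis
    proof (cases "\<tau> k \<omega>\<^sub>1 < ereal b")
      case True
      then have "\<tau> k \<omega>\<^sub>1 \<le> ereal (T k \<omega>\<^sub>1)" using X[OF k'(1), of \<omega>\<^sub>1] k' by auto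
      with ag have ag': "agree_upto (\<tau> k \<omega>\<^sub>1) \<omega>\<^sub>1 \<omega>\<^sub>2" by (rule agree_le)
      then have "\<tau> k \<omega>\<^sub>2 = \<tau> k \<omega>\<^sub>1" using st[OF k'(1)] by (auto simp: stopping_time_def)
      moreover have "\<tau> k \<omega>\<^sub>1 < \<infinity>" using True by auto
      ultimately show ?thesis
        using True k stake_agree[OF sk(1)[OF k] st[OF k'(1)] _ ag'] stake_agree[OF sk(2)[OF k] st[OF k'(1)] _ ag']
        by (auto simp: active_def)
    next
      case False
      then have "X k b \<omega>\<^sub>1 = b" using X[OF k'(1), of \<omega>\<^sub>1] by auto
      then have T: "T k \<omega>\<^sub>1 = b" using k' \<open>a \<le> b\<close> by simp
      have "\<not> \<tau> k \<omega>\<^sub>2 < ereal b"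
      proof
        assume lt: "\<tau> k \<omega>\<^sub>2 < ereal b"
        have "agree_upto (\<tau> k \<omega>\<^sub>2) \<omega>\<^sub>2 \<omega>\<^sub>1"
          by (rule agree_le[OF agree_sym[OF ag]]) (use lt T in auto)
        then have "\<tau> k \<omega>\<^sub>2 = \<tau> k \<omega>\<^sub>1" using st[OF k'(1)] by (auto simp: stopping_time_def)
        with lt False show False by simp
      qed
      with False show ?thesis by (simp add: active_def)
    qed
  qed
  have T_mono: "T k \<omega> \<le> T (Suc k) \<omega>" if "k < n + 2" for k \<omega>
  proof -
    consider "k = 0" | "k \<in> {1..n}" | "k = n + 1" using \<open>k < n + 2\<close> by force
    then show ?thesis
    proof cases
      case 2
      then have "X k b \<omega> \<le> X (Suc k) b \<omega>"
        using X[of k \<omega>] X[of "Suc k" \<omega>] le[OF 2, of \<omega>] by auto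
      with 2 show ?thesis by (auto simp: T_def)
    next
      case 3
      have "X (n+1) b \<omega> \<le> b" using X[of "n+1" \<omega>] by auto
      with 3 show ?thesis using \<open>a \<le> b\<close> by (auto simp: T_def)
    qed (auto simp: T_def \<open>a \<le> b\<close>)
  qed
  have T_stop: "adapted (T k) (T k)" for k
    unfolding adapted_def
  proof (intro allI impI)
    fix \<omega>\<^sub>1 \<omega>\<^sub>2 assume ag: "agree_upto (ereal (T k \<omega>\<^sub>1)) \<omega>\<^sub>1 \<omega>\<^sub>2"
    show "T k \<omega>\<^sub>1 = T k \<omega>\<^sub>2"
    proof (cases "k \<in> {1..n+1}")
      case True
      have "min (\<tau> k \<omega>\<^sub>1) (ereal b) = ereal (X k b \<omega>\<^sub>1)"
        unfolding X_def by (rule stop_at_le[OF st[OF True], symmetric])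
      also have "\<dots> \<le> ereal (T k \<omega>\<^sub>1)" using True by (auto simp: T_def)
      finally have "X k b \<omega>\<^sub>2 = X k b \<omega>\<^sub>1" unfolding X_def by (rule stop_at_agree[OF st[OF True] ag])
      then show ?thesis by (simp add: T_def)
    qed (auto simp: T_def)
  qed
  have pl: "plan a b (n + 2) (max B 0) T U L"
    unfolding plan_def
  proof (intro conjI allI impI)
    show "T 0 \<omega> = a" "T (n + 2) \<omega> = b" for \<omega> by (auto simp: T_def)
    show "adapted (T k) (U k)" "adapted (T k) (L k)" for k
    proof -
      have "U k \<omega>\<^sub>1 = U k \<omega>\<^sub>2 \<and> L k \<omega>\<^sub>1 = L k \<omega>\<^sub>2"
        if "agree_upto (ereal (T k \<omega>\<^sub>1)) \<omega>\<^sub>1 \<omega>\<^sub>2" for \<omega>\<^sub>1 \<omega>\<^sub>2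
      proof (cases "k \<in> {1..n}")
        case True
        then show ?thesis using active_agree[OF True that] by (auto simp: U_def L_def)
      next
        case False
        then show ?thesis by (auto simp: U_def L_def active_def)
      qed
      then show "adapted (T k) (U k)" "adapted (T k) (L k)" by (auto simp: adapted_def)
    qed
    show "U k \<omega> \<in> {0..max B 0}" "L k \<omega> \<in> {0..max B 0}" for k \<omega>
      using B[of k \<omega>] nonneg[of k \<omega>] by (auto simp: U_def L_def le_max_iff_disj)
  qed (use T_mono T_stop in auto)
  have phase: "phase_gain lo hi \<tau> h_up h_lo k (max a (min b t)) \<omega> - phase_gain lo hi \<tau> h_up h_lo k a \<omega> =
      gain lo hi (U k \<omega>) (L k \<omega>) (min (T k \<omega>) t) (min (T (Suc k) \<omega>) t) \<omega>"
    if k: "k \<in> {1..n}" for k t \<omega>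
  proof (cases "active k \<omega>")
    case True
    define F where "F x = gain lo hi (U k \<omega>) (L k \<omega>) 0 x \<omega>" for x
    have F: "gain lo hi (U k \<omega>) (L k \<omega>) x y \<omega> = F y - F x" for x y
      using gain_trans[of lo hi "U k \<omega>" "L k \<omega>" 0 x \<omega> y] by (simp add: F_def)
    \<comment> \<open>Subtracting this identity for the start of the phase from that for its end gives the claim,
      as the terms at \<open>min a t\<close> cancel.\<close>
    have shift: "F (X j (max a (min b t)) \<omega>) - F (X j a \<omega>) = F (min (T j \<omega>) t) - F (min a t)"
      if j: "j \<in> {1..n+1}" for j
    proof -
      have T: "T j \<omega> = max a (X j b \<omega>)" using j by (auto simp: T_def)
      consider "\<forall>t. X j t \<omega> = t" | p where "\<forall>t. X j t \<omega> = min p t" using X[OF j, of \<omega>] by blast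
      then show ?thesis
      proof cases
        case 1
        then show ?thesis using \<open>a \<le> b\<close> unfolding T by (auto simp: max_def min_def)
      next
        case 2
        then show ?thesis using \<open>a \<le> b\<close> unfolding T by (auto simp: max_def min_def)
      qed
    qed
    have "phase_gain lo hi \<tau> h_up h_lo k s \<omega> = F (X (Suc k) s \<omega>) - F (X k s \<omega>)" for s
      unfolding F[symmetric] using True by (simp add: phase_gain_def X_def U_def L_def)
    then show ?thesis unfolding F using shift[of k] shift[of "Suc k"] k by simp
  next
    case False
    then have ge: "ereal b \<le> \<tau> k \<omega>" "ereal b \<le> \<tau> (k+1) \<omega>" using k le[OF k, of \<omega>] by (auto simp: active_def)
    then have "X k s \<omega> = s" "X (Suc k) s \<omega> = s" if "s \<le> b" for s
      using that X[of k \<omega>] X[of "Suc k" \<omega>] k by auto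
    then have "phase_gain lo hi \<tau> h_up h_lo k s \<omega> = 0" if "s \<le> b" for s
      using that by (simp add: phase_gain_def X_def)
    then show ?thesis using False \<open>a \<le> b\<close> by (simp add: U_def L_def)
  qed
  have "(\<lambda>t \<omega>. K (max a (min b t)) \<omega> - K a \<omega>) = plan_gain lo hi (n + 2) T U L"
  proof (intro ext)
    fix t \<omega>
    have "K (max a (min b t)) \<omega> - K a \<omega> =
        (\<Sum>k=1..n. gain lo hi (U k \<omega>) (L k \<omega>) (min (T k \<omega>) t) (min (T (Suc k) \<omega>) t) \<omega>)"
      by (simp add: K_def capital_eq_sum_phase_gain phase sum_subtractf[symmetric] del: sum_subtractf)
    also have "\<dots> = plan_gain lo hi (n + 2) T U L t \<omega>"
      unfolding plan_gain_def
      by (intro sum.mono_neutral_left) (auto simp: U_def L_def active_def)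
    finally show "K (max a (min b t)) \<omega> - K a \<omega> = plan_gain lo hi (n + 2) T U L t \<omega>" .
  qed
  then show ?thesis using gainsI[OF pl] by blast
qed

section \<open>Uniform superhedging of bounded claims\<close>

text \<open>A claim on the increment over \<open>[a, b]\<close>, hedged on all paths at once from the price \<open>x\<close>. Neither
  the claim nor the price refers to the past before \<open>a\<close>.\<close>
definition superhedgeable ::
    "real \<Rightarrow> real \<Rightarrow> real \<Rightarrow> real \<Rightarrow> nat \<Rightarrow> real \<Rightarrow> real \<Rightarrow> (nat \<Rightarrow> real) \<Rightarrow> bool" where
  "superhedgeable lo hi a b n B x \<phi> \<longleftrightarrow>
     (\<exists>G\<in>gains lo hi a b n B. \<forall>\<omega>. \<phi> (N b \<omega> - N a \<omega>) \<le> x + G b \<omega>)"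

lemma superhedgeable_mono:
  assumes "superhedgeable lo hi a b n B x \<phi>" "n \<le> n'" "B \<le> B'" "x \<le> x'" "\<And>m. \<psi> m \<le> \<phi> m"
  shows "superhedgeable lo hi a b n' B' x' \<psi>"
proof -
  obtain G where G: "G \<in> gains lo hi a b n B" "\<And>\<omega>. \<phi> (N b \<omega> - N a \<omega>) \<le> x + G b \<omega>"
    using assms(1) by (auto simp: superhedgeable_def)
  have "\<psi> (N b \<omega> - N a \<omega>) \<le> x' + G b \<omega>" for \<omega>
    using G(2)[of \<omega>] assms(5)[of "N b \<omega> - N a \<omega>"] assms(4) by linarith
  moreover have "G \<in> gains lo hi a b n' B'" using G(1) assms(2,3) by (rule gains_pad)
  ultimately show ?thesis unfolding superhedgeable_def by blast
qed

text \<open>The increments are free of the past: a capital process that dominates the claim on the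
  continuations of \<open>\<eta>\<close> yields a superhedge on all paths, at the price it has reached on \<open>\<eta>\<close> at
  time \<open>a\<close>. By coherence it dominates the claim at time \<open>b\<close> already, and the strategy can
  be run on any path after replacing its past by \<open>\<eta>\<close>.\<close>
lemma superhedge_of_capital:
  assumes lohi: "0 \<le> lo" "lo \<le> hi" and K: "K \<in> capital_processes lo hi" and ab: "0 \<le> a" "a \<le> b"
    and lim: "\<And>\<omega>. agree_upto (ereal a) \<eta> \<omega> \<Longrightarrow>
      ereal (\<phi> (N b \<omega> - N a \<omega>)) \<le> Liminf at_top (\<lambda>t. ereal (K t \<omega>))"
  shows "\<exists>n B. superhedgeable lo hi a b n B (K a \<eta>) \<phi>"
proof -
  obtain n B where "(\<lambda>t \<omega>. K (max a (min b t)) \<omega> - K a \<omega>) \<in> gains lo hi a b n B"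
    using capital_restrict_gain[OF K ab(2)] by blast
  then have G: "(\<lambda>t \<omega>. K (max a (min b t)) (graft \<eta> a \<omega>) - K a (graft \<eta> a \<omega>)) \<in> gains lo hi a b n B"
    using ab(1) by (rule gains_graft)
  have "\<phi> (N b \<omega> - N a \<omega>) \<le> K a \<eta> + (K (max a (min b b)) (graft \<eta> a \<omega>) - K a (graft \<eta> a \<omega>))" for \<omega>
  proof -
    let ?\<omega> = "graft \<eta> a \<omega>"
    have ag: "agree_upto (ereal a) \<eta> ?\<omega>" by (rule agree_graft[OF ab(1) order_refl])
    have "ereal (\<phi> (N b ?\<omega> - N a ?\<omega>)) \<le> ereal (K b ?\<omega>)"
    proof (rule capital_ge_of_Liminf_ge[OF lohi K])
      show "0 \<le> b" using ab by simp
      fix \<omega>' assume ag': "agree_upto (ereal b) ?\<omega> \<omega>'"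
      then have aga: "agree_upto (ereal a) ?\<omega> \<omega>'" by (rule agree_le) (simp add: ab)
      have "N b \<omega>' - N a \<omega>' = N b ?\<omega> - N a ?\<omega>"
        using agree_N[OF ag', of b] agree_N[OF aga, of a] by simp
      then show "ereal (\<phi> (N b ?\<omega> - N a ?\<omega>)) \<le> Liminf at_top (\<lambda>t. ereal (K t \<omega>'))"
        using lim[OF agree_trans[OF ag aga]] by simp
    qed
    moreover have "K a ?\<omega> = K a \<eta>" by (rule capital_agree[OF K ag])
    ultimately show ?thesis using ab by (simp add: N_diff_graft)
  qed
  then have "superhedgeable lo hi a b n B (K a \<eta>) \<phi>"
    unfolding superhedgeable_def by (intro bexI[OF _ G] allI)
  then show ?thesis by blast
qed

text \<open>By coherence, a strategy that ends above \<open>c\<close> never falls below \<open>c\<close> on the way; so superhedging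
  a claim bounded below by \<open>c\<close> never requires capital below \<open>c\<close>.\<close>
lemma gain_floor:
  assumes lohi: "0 \<le> lo" "lo \<le> hi" and G: "G \<in> gains lo hi a b n B" and a: "0 \<le> a"
    and end_ge: "\<And>\<omega>. c \<le> x + G b \<omega>" and t: "0 \<le> t"
  shows "c \<le> x + G t \<omega>"
proof -
  have "ereal c \<le> ereal (x + G t \<omega>)"
  proof (rule capital_ge_of_Liminf_ge[OF lohi add_gain_capital_process[OF G a] t])
    fix \<omega>'
    have "\<forall>\<^sub>F t in at_top. ereal c \<le> ereal (x + G t \<omega>')"
      using eventually_ge_at_top[of b]
    proof eventually_elim
      case (elim t)
      show ?case using end_ge[of \<omega>'] by (simp only: gains_after[OF G elim] ereal_less_eq)
    qed
    then show "ereal c \<le> Liminf at_top (\<lambda>t. ereal (x + G t \<omega>'))" by (rule Liminf_bounded)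
  qed
  then show ?thesis by simp
qed

lemma superhedge_price_ge:
  assumes lohi: "0 \<le> lo" "lo \<le> hi" and a: "0 \<le> a"
    and sh: "superhedgeable lo hi a b n B x \<phi>" and ge: "\<And>m. c \<le> \<phi> m"
  shows "c \<le> x"
proof -
  obtain G where G: "G \<in> gains lo hi a b n B" and "\<And>\<omega>. \<phi> (N b \<omega> - N a \<omega>) \<le> x + G b \<omega>"
    using sh by (auto simp: superhedgeable_def)
  then have "c \<le> x + G b \<omega>" for \<omega> using ge by (meson order_trans)
  then have "c \<le> x + G a undefined" by (rule gain_floor[OF lohi G a _ a])
  then show ?thesis using gains_before[OF G order_refl] by simp
qed

lemma near_optimal_superhedge:
  assumes lohi: "0 \<le> lo" "lo \<le> hi" and a: "0 \<le> a" and ge: "\<And>m. c \<le> \<phi> m" and \<delta>: "0 < \<delta>"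
  shows "\<exists>n B. \<forall>x n' B'. superhedgeable lo hi a b n' B' x \<phi> \<longrightarrow> superhedgeable lo hi a b n B (x + \<delta>) \<phi>"
proof (cases "\<exists>x n' B'. superhedgeable lo hi a b n' B' x \<phi>")
  case True
  define X where "X = {x. \<exists>n B. superhedgeable lo hi a b n B x \<phi>}"
  have "X \<noteq> {}" using True by (auto simp: X_def)
  have "bdd_below X"
    by (rule bdd_belowI[of _ c]) (auto simp: X_def intro: superhedge_price_ge[OF lohi a _ ge])
  obtain y where "y \<in> X" "y < Inf X + \<delta>" using cInf_lessD[OF \<open>X \<noteq> {}\<close>, of "Inf X + \<delta>"] \<delta> by auto
  then obtain n B where y: "superhedgeable lo hi a b n B y \<phi>" by (auto simp: X_def)
  have "superhedgeable lo hi a b n B (x + \<delta>) \<phi>" if "superhedgeable lo hi a b n' B' x \<phi>" for x n' B'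
  proof (rule superhedgeable_mono[OF y order_refl order_refl])
    have "Inf X \<le> x" using that by (intro cInf_lower \<open>bdd_below X\<close>) (auto simp: X_def)
    then show "y \<le> x + \<delta>" using \<open>y < Inf X + \<delta>\<close> by simp
  qed simp
  then show ?thesis by blast
next
  case False
  then show ?thesis by simp
qed

text \<open>A constant stake \<open>v\<close> on jumps throughout \<open>[a, b]\<close> costs \<open>v \<cdot> hi \<cdot> (b - a)\<close> and pays \<open>v\<close> per
  jump.\<close>
lemma superhedge_tail:
  assumes sh: "superhedgeable lo hi a b n B x \<phi>" and ab: "a \<le> b" and v: "0 \<le> v"
    and le: "\<And>m. \<psi> m \<le> \<phi> m + v * real m"
  shows "superhedgeable lo hi a b n (B + v) (x + v * hi * (b - a)) \<psi>"
proof -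
  obtain G where G: "G \<in> gains lo hi a b n B" and G_ge: "\<And>\<omega>. \<phi> (N b \<omega> - N a \<omega>) \<le> x + G b \<omega>"
    using sh by (auto simp: superhedgeable_def)
  have "\<psi> (N b \<omega> - N a \<omega>) \<le> x + v * hi * (b - a) + (G b \<omega> + gain lo hi v 0 (min a b) (min b b) \<omega>)" for \<omega>
  proof -
    have "real (N b \<omega> - N a \<omega>) = real (N b \<omega>) - real (N a \<omega>)" by (simp add: of_nat_diff N_mono ab)
    then show ?thesis using le[of "N b \<omega> - N a \<omega>"] G_ge[of \<omega>] ab by (simp add: gain_def algebra_simps)
  qed
  then show ?thesis unfolding superhedgeable_def by (intro bexI[OF _ gains_add_up_stake[OF G v]] allI)
qed

text \<open>All claims bounded by \<open>C\<close> can be hedged within \<open>\<epsilon>\<close> of any price at which they can be hedged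
  at all, with one number of phases and one bound on the stakes. Raising a claim to \<open>C\<close> at \<open>M\<close> and
  more jumps costs at most \<open>2C \<cdot> hi \<cdot> (b - a) / M\<close>, by a stake of \<open>2C / M\<close> on jumps. Rounding
  up its other \<open>M\<close> values to multiples of \<open>\<delta>\<close> costs at most \<open>\<delta>\<close>. This leaves the
  finitely many claims \<open>\<psi> p\<close>, each with a near-optimal superhedge; the largest number of phases
  and the largest bound among them serve for all.\<close>
lemma uniform_superhedge:
  assumes lohi: "0 \<le> lo" "lo \<le> hi" and ab: "0 \<le> a" "a \<le> b" and C: "0 \<le> C" and \<epsilon>: "0 < \<epsilon>"
  shows "\<exists>n B. \<forall>\<phi> x n' B'. (\<forall>m. \<bar>\<phi> m\<bar> \<le> C) \<longrightarrow> superhedgeable lo hi a b n' B' x \<phi> \<longrightarrow>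
    superhedgeable lo hi a b n B (x + \<epsilon>) \<phi>"
proof -
  \<comment> \<open>One third each for rounding, for the tail, and for the near-optimal superhedge of \<open>\<psi> p\<close>.\<close>
  define \<delta> where "\<delta> = \<epsilon> / 3"
  have \<delta>: "0 < \<delta>" using \<epsilon> by (simp add: \<delta>_def)
  obtain m0 where m0: "2 * C * hi * (b - a) / \<delta> \<le> real m0" using real_arch_simple by blast
  define M where "M = Suc m0"
  have M: "0 < M" "2 * C * hi * (b - a) / \<delta> \<le> real M" using m0 by (auto simp: M_def)
  define v where "v = 2 * C / real M"
  have v: "0 \<le> v" "v * hi * (b - a) \<le> \<delta>"
    using M C \<delta> by (auto simp: v_def field_simps)
  define I where "I = {\<lfloor>- C / \<delta>\<rfloor>..\<lfloor>C / \<delta>\<rfloor>}"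
  define profiles where "profiles = {..<M} \<rightarrow>\<^sub>E I"
  define \<psi> where "\<psi> p m = (if m < M then \<delta> * (of_int (p m) + 1) else C)" for p :: "nat \<Rightarrow> int" and m
  have fin: "finite profiles" unfolding profiles_def I_def by (intro finite_PiE) auto
  have \<psi>_ge: "- C \<le> \<psi> p m" if "p \<in> profiles" for p m
  proof (cases "m < M")
    case True
    then have "p m \<in> I" using that by (auto simp: profiles_def)
    then have "- C / \<delta> \<le> of_int (p m) + 1" unfolding I_def by (simp add: floor_le_iff)
    then have "- C \<le> \<delta> * (of_int (p m) + 1)" using \<delta> by (simp add: field_simps)
    then show ?thesis using True by (simp add: \<psi>_def)
  next
    case False
    then show ?thesis using C by (simp add: \<psi>_def)
  qed
  let ?good = "\<lambda>p n B. \<forall>x n' B'. superhedgeable lo hi a b n' B' x (\<psi> p) \<longrightarrow>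
      superhedgeable lo hi a b n B (x + \<delta>) (\<psi> p)"
  have near: "\<exists>n B. ?good p n B" if "p \<in> profiles" for p
    by (rule near_optimal_superhedge[OF lohi ab(1) \<psi>_ge[OF that] \<delta>])
  have "\<exists>n. \<forall>p\<in>profiles. \<exists>B. ?good p n B"
  proof (rule finite_uniform[OF fin near])
    fix p and m m' :: nat assume "\<exists>B. ?good p m B" "m \<le> m'"
    then show "\<exists>B. ?good p m' B" by (meson order_refl superhedgeable_mono)
  qed
  then obtain n where n: "\<And>p. p \<in> profiles \<Longrightarrow> \<exists>B. ?good p n B" by blast
  have "\<exists>B. \<forall>p\<in>profiles. ?good p n B"
  proof (rule finite_uniform[OF fin n])
    fix p and m m' :: real assume "?good p n m" "m \<le> m'"
    then show "?good p n m'" by (meson order_refl superhedgeable_mono)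
  qed
  then obtain B where B: "\<And>p. p \<in> profiles \<Longrightarrow> ?good p n B" by blast
  have "superhedgeable lo hi a b n B (x + \<epsilon>) \<phi>"
    if \<phi>: "\<And>m. \<bar>\<phi> m\<bar> \<le> C" and sh: "superhedgeable lo hi a b n' B' x \<phi>" for \<phi> x n' B'
  proof -
    define p where "p = (\<lambda>m\<in>{..<M}. \<lfloor>\<phi> m / \<delta>\<rfloor>)"
    have "\<lfloor>\<phi> m / \<delta>\<rfloor> \<in> I" for m
    proof -
      have "- C / \<delta> \<le> \<phi> m / \<delta>" "\<phi> m / \<delta> \<le> C / \<delta>"
        using \<phi>[of m] \<delta> by (intro divide_right_mono; simp add: abs_le_iff)+
      then show ?thesis unfolding I_def by (simp only: atLeastAtMost_iff floor_mono simp_thms)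
    qed
    then have p: "p \<in> profiles" by (auto simp: p_def profiles_def)
    have \<phi>_le: "\<phi> m \<le> \<psi> p m" for m
    proof (cases "m < M")
      case True
      have "\<phi> m / \<delta> \<le> of_int \<lfloor>\<phi> m / \<delta>\<rfloor> + 1" by linarith
      then show ?thesis using True \<delta> by (simp add: \<psi>_def p_def field_simps)
    next
      case False
      then show ?thesis using \<phi>[of m] by (simp add: \<psi>_def)
    qed
    have \<psi>_le: "\<psi> p m \<le> (\<phi> m + \<delta>) + v * real m" for m
    proof (cases "m < M")
      case True
      have "\<delta> * of_int \<lfloor>\<phi> m / \<delta>\<rfloor> \<le> \<delta> * (\<phi> m / \<delta>)" using \<delta> by (intro mult_left_mono) auto
      then have "\<psi> p m \<le> \<phi> m + \<delta>" using True \<delta> by (simp add: \<psi>_def p_def algebra_simps)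
      then show ?thesis using v by (simp add: add_increasing2)
    next
      case False
      then have "2 * C \<le> v * real m"
        using M C mult_left_mono[of "real M" "real m" "2 * C"] by (simp add: v_def field_simps)
      then show ?thesis using False \<phi>[of m] \<delta> by (simp add: \<psi>_def abs_le_iff)
    qed
    have "superhedgeable lo hi a b n' B' (x + \<delta>) (\<lambda>m. \<phi> m + \<delta>)"
      using sh by (auto simp: superhedgeable_def algebra_simps)
    then have "superhedgeable lo hi a b n' (B' + v) (x + \<delta> + v * hi * (b - a)) (\<psi> p)"
      using ab(2) v(1) \<psi>_le by (rule superhedge_tail)
    then have "superhedgeable lo hi a b n B (x + \<delta> + v * hi * (b - a) + \<delta>) (\<psi> p)" using B[OF p] by blast
    then show ?thesis
      by (rule superhedgeable_mono) (use v \<phi>_le in \<open>auto simp: \<delta>_def\<close>)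
  qed
  then show ?thesis by blast
qed

section \<open>The tower property\<close>

text \<open>The capital processes over which the conditional upper expectation at the constant time \<open>s\<close>
  minimises.\<close>
definition dominating ::
    "real \<Rightarrow> real \<Rightarrow> (counting_path \<rightharpoonup> ereal) \<Rightarrow> real \<Rightarrow> counting_path \<Rightarrow>
     (real \<Rightarrow> counting_path \<Rightarrow> real) set" where
  "dominating lo hi f s \<omega> = {K \<in> capital_processes lo hi. (\<exists>c. \<forall>t\<ge>0. \<forall>\<omega>'. c \<le> K t \<omega>') \<and>
     (\<forall>\<omega>'. agree_upto (ereal s) \<omega> \<omega>' \<longrightarrow> the (f \<omega>') \<le> Liminf at_top (\<lambda>t. ereal (K t \<omega>')))}"

lemma INF_gt_MInf_iff:
  fixes h :: "'a \<Rightarrow> real"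
  shows "(INF x\<in>A. ereal (h x)) > -\<infinity> \<longleftrightarrow> (\<exists>c. \<forall>x\<in>A. c \<le> h x)"
proof
  assume "(INF x\<in>A. ereal (h x)) > -\<infinity>"
  then obtain c :: real where "ereal c < (INF x\<in>A. ereal (h x))"
    using ereal_dense2 by blast
  then have "ereal c \<le> ereal (h x)" if "x \<in> A" for x
    using that by (meson INF_lower less_imp_le order_trans)
  then show "\<exists>c. \<forall>x\<in>A. c \<le> h x" by auto
next
  assume "\<exists>c. \<forall>x\<in>A. c \<le> h x"
  then obtain c where "\<And>x. x \<in> A \<Longrightarrow> c \<le> h x" by blast
  then have "ereal c \<le> (INF x\<in>A. ereal (h x))" by (intro INF_greatest) simp
  moreover have "-\<infinity> < ereal c" by simp
  ultimately show "(INF x\<in>A. ereal (h x)) > -\<infinity>" by (rule less_le_trans[rotated])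
qed

lemma upper_expectation_const_time:
  "upper_expectation lo hi f (const_time s) \<omega> = Some (INF K\<in>dominating lo hi f s \<omega>. ereal (K s \<omega>))"
proof -
  have "(INF (t, \<omega>')\<in>{0..}\<times>UNIV. ereal (K t \<omega>')) > -\<infinity> \<longleftrightarrow> (\<exists>c. \<forall>t\<ge>0. \<forall>\<omega>'. c \<le> K t \<omega>')"
    for K :: "real \<Rightarrow> counting_path \<Rightarrow> real"
  proof -
    have "(\<forall>x\<in>{0..}\<times>UNIV. c \<le> K (fst x) (snd x)) \<longleftrightarrow> (\<forall>t\<ge>0. \<forall>\<omega>'. c \<le> K t \<omega>')" for c by auto
    then show ?thesis
      using INF_gt_MInf_iff[of "\<lambda>x. K (fst x) (snd x)" "{0..}\<times>UNIV"] by (simp only: case_prod_unfold)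
  qed
  then show ?thesis
    unfolding upper_expectation_def dominating_def atom_def const_time_def
    by (simp add: setcompr_eq_image)
qed

lemma upper_expectation_agree:
  assumes ag: "agree_upto (ereal s) \<eta> \<omega>"
  shows "upper_expectation lo hi f (const_time s) \<omega> = upper_expectation lo hi f (const_time s) \<eta>"
proof -
  have "agree_upto (ereal s) \<omega> \<omega>' \<longleftrightarrow> agree_upto (ereal s) \<eta> \<omega>'" for \<omega>'
    using agree_trans[OF ag] agree_trans[OF agree_sym[OF ag]] by blast
  then have "dominating lo hi f s \<omega> = dominating lo hi f s \<eta>" by (simp add: dominating_def)
  moreover have "K s \<omega> = K s \<eta>" if "K \<in> dominating lo hi f s \<eta>" for K
    by (rule capital_agree[of K lo hi, OF _ ag]) (use that in \<open>simp add: dominating_def\<close>)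
  ultimately have "(INF K\<in>dominating lo hi f s \<omega>. ereal (K s \<omega>)) =
      (INF K\<in>dominating lo hi f s \<eta>. ereal (K s \<eta>))"
    by (intro INF_cong) auto
  then show ?thesis by (simp add: upper_expectation_const_time)
qed

lemma capital_before:
  assumes K: "K \<in> capital_processes lo hi" and a: "0 \<le> a"
  shows "\<exists>n B c. \<exists>G\<in>gains lo hi 0 a n B. \<forall>t\<ge>0. \<forall>\<omega>. c + G t \<omega> = K (min a t) \<omega>"
proof -
  obtain c where c: "\<And>\<omega>. K 0 \<omega> = c" using capital_zero[OF K] by blast
  obtain n B where G: "(\<lambda>t \<omega>. K (max 0 (min a t)) \<omega> - K 0 \<omega>) \<in> gains lo hi 0 a n B"
    using capital_restrict_gain[OF K a] by blast
  have "c + (K (max 0 (min a t)) \<omega> - K 0 \<omega>) = K (min a t) \<omega>" if "0 \<le> t" for t \<omega>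
    using that a by (simp add: c max_absorb2)
  then show ?thesis by (intro exI[of _ n] exI[of _ B] exI[of _ c] bexI[OF _ G] allI impI)
qed

lemma Liminf_ge_of_eventually_const:
  assumes "\<And>t. b \<le> t \<Longrightarrow> c \<le> ereal (h t)"
  shows "c \<le> Liminf at_top (\<lambda>t::real. ereal (h t))"
  by (rule Liminf_bounded, rule eventually_mono[OF eventually_ge_at_top[of b]]) (rule assms)

text \<open>Freezing the capital at time \<open>a\<close> leaves a process that dominates the conditional upper
  expectation: from every continuation at time \<open>a\<close> onwards, the original process is itself one
  of the candidates over which that expectation minimises.\<close>
lemma stopped_dominates_conditional:
  assumes sa: "0 \<le> s" "s \<le> a" and K: "K \<in> dominating lo hi f s \<omega>"
  shows "\<exists>K'\<in>dominating lo hi (upper_expectation lo hi f (const_time a)) s \<omega>. K' s \<omega> = K s \<omega>"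
proof -
  have cap: "K \<in> capital_processes lo hi" using K by (simp add: dominating_def)
  have a: "0 \<le> a" using sa by simp
  obtain G n B c where G: "G \<in> gains lo hi 0 a n B"
    and eq: "\<And>t \<omega>. 0 \<le> t \<Longrightarrow> c + G t \<omega> = K (min a t) \<omega>"
    using capital_before[OF cap a] by blast
  have "(\<lambda>t \<omega>. c + G t \<omega>) \<in> dominating lo hi (upper_expectation lo hi f (const_time a)) s \<omega>"
    unfolding dominating_def
  proof (intro CollectI conjI allI impI)
    show "(\<lambda>t \<omega>. c + G t \<omega>) \<in> capital_processes lo hi"
      using G order_refl by (rule add_gain_capital_process)
    obtain d where "\<And>t \<omega>. 0 \<le> t \<Longrightarrow> d \<le> K t \<omega>" using K by (auto simp: dominating_def)
    then show "\<exists>d. \<forall>t\<ge>0. \<forall>\<omega>'. d \<le> c + G t \<omega>'" using a by (intro exI[of _ d]) (simp add: eq)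
    fix \<omega>' assume ag: "agree_upto (ereal s) \<omega> \<omega>'"
    have "K \<in> dominating lo hi f a \<omega>'"
      using K agree_trans[OF ag agree_le[of "ereal a"]] sa by (auto simp: dominating_def)
    then have "the (upper_expectation lo hi f (const_time a) \<omega>') \<le> ereal (K a \<omega>')"
      by (auto simp: upper_expectation_const_time intro: INF_lower)
    then show "the (upper_expectation lo hi f (const_time a) \<omega>') \<le>
        Liminf at_top (\<lambda>t. ereal (c + G t \<omega>'))"
      using a by (intro Liminf_ge_of_eventually_const[of a]) (simp add: eq)
  qed
  then show ?thesis using eq[OF sa(1), of \<omega>] sa(2) by (intro bexI) (auto simp: min_absorb2)
qed

text \<open>Conversely, let \<open>K\<close> dominate the conditional upper expectation. By coherence its capital at time
  \<open>a\<close> is at least that expectation, hence enough up to \<open>\<epsilon>\<close> to superhedge the remaining claim.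
  Follow \<open>K\<close> up to \<open>a\<close> and then a superhedge chosen according to the path so far; the
  superhedges are taken with a common number of phases and a common bound on the stakes, so
  that this is again one strategy. The choice depends on the past only through \<open>K a\<close> and
  the remaining claim, and falls back on not trading where no superhedge exists, which
  happens only outside the atom of \<open>\<omega>\<close>.\<close>
lemma conditional_dominated_then_dominated:
  assumes lohi: "0 \<le> lo" "lo \<le> hi" and sab: "0 \<le> s" "s \<le> a" "a \<le> b" and \<epsilon>: "0 < \<epsilon>"
    and \<phi>_agree: "\<And>\<eta> \<omega>. agree_upto (ereal a) \<eta> \<omega> \<Longrightarrow> \<phi> \<omega> = \<phi> \<eta>"
    and \<phi>_bound: "\<And>\<eta> m. \<bar>\<phi> \<eta> m\<bar> \<le> C"
    and f: "\<And>\<omega>. f \<omega> = Some (ereal (\<phi> \<omega> (N b \<omega> - N a \<omega>)))"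
    and K: "K \<in> dominating lo hi (upper_expectation lo hi f (const_time a)) s \<omega>"
  shows "\<exists>K'\<in>dominating lo hi f s \<omega>. K' s \<omega> \<le> K s \<omega> + \<epsilon>"
proof -
  let ?E = "upper_expectation lo hi f (const_time a)"
  have cap: "K \<in> capital_processes lo hi" using K by (simp add: dominating_def)
  obtain d where d: "\<And>t \<omega>. 0 \<le> t \<Longrightarrow> d \<le> K t \<omega>" using K by (auto simp: dominating_def)
  have a: "0 \<le> a" using sab by simp
  have C: "0 \<le> C" using \<phi>_bound[of \<omega> 0] by linarith
  have hedge: "\<exists>n B. superhedgeable lo hi a b n B (K a \<eta> + \<epsilon> / 2) (\<phi> \<eta>)"
    if ag: "agree_upto (ereal s) \<omega> \<eta>" for \<eta>
  proof -
    have "the (?E \<eta>) \<le> ereal (K a \<eta>)"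
    proof (rule capital_ge_of_Liminf_ge[OF lohi cap a])
      fix \<omega>' assume ag': "agree_upto (ereal a) \<eta> \<omega>'"
      have "agree_upto (ereal s) \<omega> \<omega>'" by (rule agree_trans[OF ag agree_le[OF ag']]) (simp add: sab)
      then have "the (?E \<omega>') \<le> Liminf at_top (\<lambda>t. ereal (K t \<omega>'))" using K by (simp add: dominating_def)
      then show "the (?E \<eta>) \<le> Liminf at_top (\<lambda>t. ereal (K t \<omega>'))"
        using upper_expectation_agree[OF ag'] by simp
    qed
    also have "\<dots> < ereal (K a \<eta> + \<epsilon> / 2)" using \<epsilon> by simp
    finally obtain K' where K': "K' \<in> dominating lo hi f a \<eta>" and lt: "K' a \<eta> < K a \<eta> + \<epsilon> / 2"
      by (auto simp: upper_expectation_const_time INF_less_iff)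
    have "\<exists>n B. superhedgeable lo hi a b n B (K' a \<eta>) (\<phi> \<eta>)"
    proof (rule superhedge_of_capital[OF lohi _ a sab(3)])
      show "K' \<in> capital_processes lo hi" using K' by (simp add: dominating_def)
      fix \<omega>' assume ag': "agree_upto (ereal a) \<eta> \<omega>'"
      then have "the (f \<omega>') \<le> Liminf at_top (\<lambda>t. ereal (K' t \<omega>'))" using K' by (simp add: dominating_def)
      then show "ereal (\<phi> \<eta> (N b \<omega>' - N a \<omega>')) \<le> Liminf at_top (\<lambda>t. ereal (K' t \<omega>'))"
        using \<phi>_agree[OF ag'] by (simp add: f)
    qed
    then obtain n B where "superhedgeable lo hi a b n B (K' a \<eta>) (\<phi> \<eta>)" by blast
    then have "superhedgeable lo hi a b n B (K a \<eta> + \<epsilon> / 2) (\<phi> \<eta>)"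
      by (rule superhedgeable_mono) (use lt in auto)
    then show ?thesis by blast
  qed
  have "0 < \<epsilon> / 2" using \<epsilon> by simp
  from uniform_superhedge[OF lohi a sab(3) C this] obtain n0 B0 where uniform:
    "\<And>\<phi> x n' B'. (\<forall>m. \<bar>\<phi> m\<bar> \<le> C) \<Longrightarrow> superhedgeable lo hi a b n' B' x \<phi> \<Longrightarrow>
       superhedgeable lo hi a b n0 B0 (x + \<epsilon> / 2) \<phi>" by blast
  obtain G1 n1 B1 c where G1: "G1 \<in> gains lo hi 0 a n1 B1"
    and G1_eq: "\<And>t \<omega>. 0 \<le> t \<Longrightarrow> c + G1 t \<omega> = K (min a t) \<omega>"
    using capital_before[OF cap a] by blast
  define n B where "n = Suc n0" and "B = max 0 (max B0 B1)"
  define good where "good \<eta> G \<longleftrightarrow> G \<in> gains lo hi a b n B \<and>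
      (\<forall>\<omega>. \<phi> \<eta> (N b \<omega> - N a \<omega>) \<le> K a \<eta> + \<epsilon> + G b \<omega>)" for \<eta> G
  define S where "S \<eta> = (if \<exists>G. good \<eta> G then SOME G. good \<eta> G else (\<lambda>_ _. 0))" for \<eta>
  have S_good: "good \<eta> (S \<eta>)" if "\<exists>G. good \<eta> G" for \<eta>
    using that someI_ex[OF that] by (simp add: S_def)
  have good_exists: "\<exists>G. good \<eta> G" if ag: "agree_upto (ereal s) \<omega> \<eta>" for \<eta>
  proof -
    obtain n' B' where "superhedgeable lo hi a b n' B' (K a \<eta> + \<epsilon> / 2) (\<phi> \<eta>)" using hedge[OF ag] by blast
    then have "superhedgeable lo hi a b n0 B0 (K a \<eta> + \<epsilon> / 2 + \<epsilon> / 2) (\<phi> \<eta>)"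
      using \<phi>_bound by (intro uniform) auto
    then have "superhedgeable lo hi a b n B (K a \<eta> + \<epsilon>) (\<phi> \<eta>)"
      by (rule superhedgeable_mono) (auto simp: n_def B_def)
    then show ?thesis by (auto simp: superhedgeable_def good_def)
  qed
  have S_gains: "S \<eta> \<in> gains lo hi a b n B" for \<eta>
  proof (cases "\<exists>G. good \<eta> G")
    case True
    then show ?thesis using S_good by (simp add: good_def)
  next
    case False
    then show ?thesis by (simp add: S_def gains_zero sab n_def B_def)
  qed
  have S_agree: "S \<omega>\<^sub>1 = S \<omega>\<^sub>2" if "agree_upto (ereal a) \<omega>\<^sub>1 \<omega>\<^sub>2" for \<omega>\<^sub>1 \<omega>\<^sub>2
  proof -
    have "good \<omega>\<^sub>1 = good \<omega>\<^sub>2"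
      using \<phi>_agree[OF that] capital_agree[OF cap that] by (simp add: good_def fun_eq_iff)
    then show ?thesis by (simp add: S_def)
  qed
  have SG: "(\<lambda>t \<omega>. S \<omega> t \<omega>) \<in> gains lo hi a b n B"
    by (rule gains_choice[OF S_gains _ S_agree]) (simp_all add: B_def)
  have "G1 \<in> gains lo hi 0 a n1 B" by (rule gains_pad[OF G1]) (simp_all add: B_def)
  then have "(\<lambda>t \<omega>. G1 t \<omega> + S \<omega> t \<omega>) \<in> gains lo hi 0 b (n1 + n) B" using SG by (rule gains_concat)
  then have "(\<lambda>t \<omega>. (c + \<epsilon>) + (G1 t \<omega> + S \<omega> t \<omega>)) \<in> capital_processes lo hi"
    by (rule add_gain_capital_process) simp
  moreover define K' where "K' = (\<lambda>t \<omega>. (c + \<epsilon>) + (G1 t \<omega> + S \<omega> t \<omega>))"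
  ultimately have cap': "K' \<in> capital_processes lo hi" by simp
  have K'_eq: "K' t \<eta> = K (min a t) \<eta> + \<epsilon> + S \<eta> t \<eta>" if "0 \<le> t" for t \<eta>
    using G1_eq[OF that, of \<eta>] by (simp add: K'_def)
  have before: "K' t \<eta> = K t \<eta> + \<epsilon>" if "0 \<le> t" "t \<le> a" for t \<eta>
    using that K'_eq[OF that(1)] gains_before[OF S_gains that(2)] by (simp add: min_absorb2)
  \<comment> \<open>Superhedges of claims bounded by \<open>C\<close> keep the total capital above \<open>-C\<close> after \<open>a\<close>, even though
    they are chosen separately on infinitely many atoms.\<close>
  have "min d (- C) \<le> K' t \<eta>" if t: "0 \<le> t" for t \<eta>
  proof (cases "t \<le> a")
    case True
    then show ?thesis using before[OF t True, of \<eta>] d[OF t, of \<eta>] \<epsilon> by simp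
  next
    case False
    then have eq: "K' t \<eta> = K a \<eta> + \<epsilon> + S \<eta> t \<eta>" using K'_eq[OF t] by (simp add: min_absorb1)
    show ?thesis
    proof (cases "\<exists>G. good \<eta> G")
      case True
      then have "- C \<le> K a \<eta> + \<epsilon> + S \<eta> b \<omega>'" for \<omega>'
        using S_good[OF True] \<phi>_bound[of \<eta> "N b \<omega>' - N a \<omega>'"] unfolding good_def abs_le_iff
        by (smt (verit))
      then have "- C \<le> K a \<eta> + \<epsilon> + S \<eta> t \<eta>"
        using t by (rule gain_floor[OF lohi S_gains a])
      then show ?thesis using eq by simp
    next
      case False
      then show ?thesis using eq d[OF a, of \<eta>] \<epsilon> by (simp add: S_def)
    qed
  qed
  moreover have "the (f \<omega>') \<le> Liminf at_top (\<lambda>t. ereal (K' t \<omega>'))"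
    if ag: "agree_upto (ereal s) \<omega> \<omega>'" for \<omega>'
  proof (rule Liminf_ge_of_eventually_const[of b])
    fix t assume t: "b \<le> t"
    have "K' t \<omega>' = K a \<omega>' + \<epsilon> + S \<omega>' b \<omega>'"
      using t sab a K'_eq[of t \<omega>'] gains_after[OF S_gains t] by (simp add: min_absorb1)
    then show "the (f \<omega>') \<le> ereal (K' t \<omega>')"
      using S_good[OF good_exists[OF ag]] by (simp add: good_def f)
  qed
  ultimately have "K' \<in> dominating lo hi f s \<omega>" using cap' unfolding dominating_def by blast
  then show ?thesis using before[OF sab(1,2), of \<omega>] by (intro bexI[of _ K']) simp
qed

text \<open>The claim may depend on the whole past up to \<open>a\<close>, and after \<open>a\<close> only on the increment up to \<open>b\<close>.\<close>
lemma upper_expectation_tower: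
  assumes lohi: "0 \<le> lo" "lo \<le> hi" and sab: "0 \<le> s" "s \<le> a" "a \<le> b"
    and \<phi>_agree: "\<And>\<eta> \<omega>. agree_upto (ereal a) \<eta> \<omega> \<Longrightarrow> \<phi> \<omega> = \<phi> \<eta>"
    and \<phi>_bound: "\<And>\<eta> m. \<bar>\<phi> \<eta> m\<bar> \<le> C"
    and f: "\<And>\<omega>. f \<omega> = Some (ereal (\<phi> \<omega> (N b \<omega> - N a \<omega>)))"
  shows "upper_expectation lo hi f (const_time s) =
    upper_expectation lo hi (upper_expectation lo hi f (const_time a)) (const_time s)"
proof
  fix \<omega>
  let ?E = "upper_expectation lo hi f (const_time a)"
  have "(INF K\<in>dominating lo hi f s \<omega>. ereal (K s \<omega>)) = (INF K\<in>dominating lo hi ?E s \<omega>. ereal (K s \<omega>))"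
  proof (rule antisym)
    show "(INF K\<in>dominating lo hi f s \<omega>. ereal (K s \<omega>)) \<le> (INF K\<in>dominating lo hi ?E s \<omega>. ereal (K s \<omega>))"
    proof (rule INF_greatest)
      fix K assume K: "K \<in> dominating lo hi ?E s \<omega>"
      show "(INF K\<in>dominating lo hi f s \<omega>. ereal (K s \<omega>)) \<le> ereal (K s \<omega>)"
      proof (rule ereal_le_epsilon2)
        fix \<epsilon> :: real assume "0 < \<epsilon>"
        from conditional_dominated_then_dominated[OF lohi sab this \<phi>_agree \<phi>_bound f K]
        obtain K' where "K' \<in> dominating lo hi f s \<omega>" "K' s \<omega> \<le> K s \<omega> + \<epsilon>" by blast
        then show "(INF K\<in>dominating lo hi f s \<omega>. ereal (K s \<omega>)) \<le> ereal (K s \<omega>) + ereal \<epsilon>"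
          by (intro INF_lower2[of K']) auto
      qed
    qed
    show "(INF K\<in>dominating lo hi ?E s \<omega>. ereal (K s \<omega>)) \<le> (INF K\<in>dominating lo hi f s \<omega>. ereal (K s \<omega>))"
    proof (rule INF_mono)
      fix K assume "K \<in> dominating lo hi f s \<omega>"
      from stopped_dominates_conditional[OF sab(1,2) this]
      obtain K' where "K' \<in> dominating lo hi ?E s \<omega>" "K' s \<omega> = K s \<omega>" by blast
      then show "\<exists>K'\<in>dominating lo hi ?E s \<omega>. ereal (K' s \<omega>) \<le> ereal (K s \<omega>)"
        by (intro bexI[of _ K']) simp_all
    qed
  qed
  then show "upper_expectation lo hi f (const_time s) \<omega> =
      upper_expectation lo hi ?E (const_time s) \<omega>"
    by (simp add: upper_expectation_const_time)
qed

theorem theorem1: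
  fixes lo hi :: real and k :: nat and t :: "nat \<Rightarrow> real" and g :: "nat list \<Rightarrow> real"
  assumes "0 \<le> lo" and "lo \<le> hi"
    and "1 \<le> k"
    and "0 \<le> t 1" and "strict_mono_on {1..k+1} t"
    and "bounded (g ` {xs. length xs = k + 1})"
  shows "upper_expectation lo hi
           (\<lambda>\<omega>. Some (ereal (g (map (\<lambda>i. N (t i) \<omega>) [1..<k+2])))) (const_time (t 1)) =
         upper_expectation lo hi
           (upper_expectation lo hi
             (\<lambda>\<omega>. Some (ereal (g (map (\<lambda>i. N (t i) \<omega>) [1..<k+2])))) (const_time (t k)))
           (const_time (t 1))"
proof -
  define \<phi> where "\<phi> \<omega> m = g (map (\<lambda>i. N (t i) \<omega>) [1..<k+1] @ [N (t k) \<omega> + m])" for \<omega> m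
  have t_le: "t i \<le> t j" if "1 \<le> i" "i \<le> j" "j \<le> k + 1" for i j
    using strict_mono_on_leD[OF assms(5), of i j] that by auto
  obtain C where C: "\<And>xs. length xs = k + 1 \<Longrightarrow> \<bar>g xs\<bar> \<le> C"
    using assms(6) unfolding bounded_iff by auto
  show ?thesis
  proof (rule upper_expectation_tower[of lo hi "t 1" "t k" "t (k+1)" \<phi> C])
    show "t 1 \<le> t k" "t k \<le> t (k + 1)" using assms(3) by (auto intro: t_le)
    show "\<bar>\<phi> \<eta> m\<bar> \<le> C" for \<eta> m unfolding \<phi>_def by (rule C) simp
    show "\<phi> \<omega> = \<phi> \<eta>" if ag: "agree_upto (ereal (t k)) \<eta> \<omega>" for \<eta> \<omega>
    proof -
      have "N (t i) \<omega> = N (t i) \<eta>" if "i \<in> {1..k}" for i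
        using agree_N[OF ag, of "t i"] t_le[of i k] that by simp
      then have "map (\<lambda>i. N (t i) \<omega>) [1..<k+1] = map (\<lambda>i. N (t i) \<eta>) [1..<k+1]" "N (t k) \<omega> = N (t k) \<eta>"
        using assms(3) by auto
      then show ?thesis unfolding \<phi>_def by presburger
    qed
    show "Some (ereal (g (map (\<lambda>i. N (t i) \<omega>) [1..<k+2]))) =
        Some (ereal (\<phi> \<omega> (N (t (k+1)) \<omega> - N (t k) \<omega>)))" for \<omega>
    proof -
      have "N (t k) \<omega> + (N (t (k+1)) \<omega> - N (t k) \<omega>) = N (t (k+1)) \<omega>"
        using N_mono[OF t_le[of k "k+1"], of \<omega>] assms(3) by simp
      then show ?thesis by (simp add: \<phi>_def)
    qed
  qed (use assms in auto)
qed

end
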